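(* Let the controlled Markov process $(X_n)_{n=0}^N$, the training distribution $\mu$, the transition density $r\le\bar R^2$, the bounded measurable rewards $f,g$, the value function $V$ with its bound $\Gamma$, the basis functions $\phi_1,\dots,\phi_K$ (with Gram matrix $\mathcal{A}_K$), and the regress-later performance iteration algorithm with $M$ training points per time step be as in the context, with $f(n,x,\cdot)$ and $\hat\phi^n_k(x,\cdot)$ upper semicontinuous in $u$. Let $\tilde V$ be the exact performance of the policy $(\hat u_n)$ estimated by performance iteration (defined in the context). Then for all $n=0,1,\dots,N$ \[ \Big\|\tilde V(n,\tilde X)-V(n,\tilde X)\Big\|_{L^2_{f,n}}\le 2\bar R\,\frac{(3\bar R)^{N-n}-1}{3\bar R-1}\Big(\epsilon_K+\frac{\sqrt K}{\sqrt M}\,\Gamma\,\|\mathcal{A}_K^{-1/2}\|_2\max_{k=1,\dots,K}\|\phi_k\|_{L^2_\mu}\Big), \] where $\epsilon_K=\max_{n=1,\dots,N}\big\|\Pi_K V(n,\cdot)-V(n,\cdot)\big\|_{L^2_\mu}$.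
   Context: Controlled process. $\mathcal{D}\subseteq\mathbb{R}^d$ is the (Borel) state space, $\mathcal{D}^U\subset\mathbb{R}^q$ is a compact set of control values, $N,M,K\ge 1$ are integers. The process is $X_{n+1}=\varphi(n,X_n,\xi_n,u_n)$, $n=0,\dots,N-1$, with $\varphi$ Borel measurable, $(\xi_n)$ i.i.d. uniform on $[0,1]$, and feedback controls $u_n=u_n(X_n)\in\mathcal{D}^U$ (the set of such controls is $\mathcal{U}$). Density. $\mu$ is a probability measure on $\mathcal{D}$ and $X$ has a (jointly measurable) transition density: $\mathbb{P}(X_{n+1}\in A\mid X_n=x,u_n=u)=\mathbb{P}(\varphi(n,x,\xi_n,u)\in A)=\int_A r(n,x,u;y)\,\mu(dy)$, with $r(n,x,u;y)\le\bar R^2$ for all $n,x,u,y$, where $\bar R>0$ is a constant (necessarily $\bar R\ge1$). Rewards and value function. $f(n,x,u)$ and $g(x)$ are measurable and bounded. $V(n,x)=\sup_{u\in\mathcal{U}}\mathbb{E}\big[\sum_{s=n}^{N-1}f(s,X_s,u_s)+g(X_N)\mid X_n=x\big]$; equivalently $V(N,x)=g(x)$ and $V(n,x)=\max_{u\in\mathcal{D}^U}\{f(n,x,u)+\mathbb{E}[V(n+1,X_{n+1})\mid X_n=x,u_n=u]\}$. Functions of $x$ obtained by optimising over $u$ are understood to be measurable. $\Gamma$ is a constant bounding the value function: $|V(n,x)|\le\Gamma$ for all $n=1,\dots,N$ and $x\in\mathcal{D}$; by boundedness of $f$ and $g$ such a constant exists with $\Gamma\le\bar\Gamma:=(N-1)\|f\|_\infty+\|g\|_\infty$.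 Basis functions. $L^2_\mu=L^2(\mathcal{D},\mu)$. $\phi_1,\dots,\phi_K\in L^2_\mu$ are linearly independent, $\pmb\phi=(\phi_1,\dots,\phi_K)^T$, $\mathcal{A}_K=\int\pmb\phi\pmb\phi^T d\mu$ (a $K\times K$ matrix), $\|\cdot\|_2$ of a matrix is the operator norm induced by the Euclidean norm. $\Pi_K$ is the orthogonal projection in $L^2_\mu$ onto $\mathrm{lin}(\phi_1,\dots,\phi_K)$. $\hat\phi_k^n(x,u)=\mathbb{E}[\phi_k(X_{n+1})\mid X_n=x,u_n=u]=\int_{\mathcal{D}}\phi_k(y)r(n,x,u;y)\mu(dy)$. Performance iteration. Let $\tilde X^m_n\sim\mu$ ($m=1,\dots,M$, $n=1,\dots,N$) and $\xi^{n,m}_s\sim U(0,1)$ ($m=1,\dots,M$, $n=1,\dots,N-1$, $s=n,\dots,N-1$) all be independent. Proceed backwards. At time $N$: $\hat J(N,m)=g(\tilde X^m_N)$ and $\hat{\pmb\alpha}^N=\mathcal{A}_K^{-1}\frac1M\sum_{m=1}^M\hat J(N,m)\pmb\phi(\tilde X_N^m)$. For $n=N-1,\dots,0$: let $\hat u_n(x)\in\mathrm{argmax}_{u\in\mathcal{D}^U}\{f(n,x,u)+\sum_{k=1}^K\hat\alpha_k^{n+1}\hat\phi_k^n(x,u)\}$ be a maximiser (taken to exist and to be jointly measurable in $x$ and the random variables on which $\hat{\pmb\alpha}^{n+1}$ depends); then, for $n\ge1$ and each $m$, simulate $X^{n,m}_n=\tilde X^m_n$, $X^{n,m}_{s+1}=\varphi(s,X^{n,m}_s,\xi^{n,m}_s,\hat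 u_s(X^{n,m}_s))$ for $s=n,\dots,N-1$, and set $\hat J(n,m)=\sum_{s=n}^{N-1}f(s,X^{n,m}_s,\hat u_s(X^{n,m}_s))+g(X^{n,m}_N)$ and $\hat{\pmb\alpha}^n=\mathcal{A}_K^{-1}\frac1M\sum_{m=1}^M\hat J(n,m)\pmb\phi(\tilde X_n^m)$. Performance of the estimated policy. $\tilde V(N,x)=g(x)$ and $\tilde V(n,x)=f(n,x,\hat u_n(x))+\int_{\mathcal{D}}\tilde V(n+1,y)\,r(n,x,\hat u_n(x);y)\,\mu(dy)$ for $n<N$, i.e. $\tilde V(n,x)=\mathbb{E}\big[\sum_{s=n}^{N-1}f(s,X_s,\hat u_s(X_s))+g(X_N)\mid X_n=x\big]$ where $X$ is driven by the estimated policy and by fresh noise, all simulation variables used to construct the policy being held fixed. Norm. Let $\tilde{\mathfrak Y}_{n+1}$ denote the collection of all $\tilde X^m_j$ and $\xi^{j,m}_s$ with $j\ge n+1$ ($m=1,\dots,M$, $s=j,\dots,N-1$); it is empty for $n=N$. Both $\hat u_n$ and $\tilde V(n,\cdot)$ depend on the simulation only through $\tilde{\mathfrak Y}_{n+1}$. $L^2_{f,n}$ is the $L^2$ space of functions of $(\tilde{\mathfrak Y}_{n+1},\tilde X)$, where $\tilde X\sim\mu$ is independent of $\tilde{\mathfrak Y}_{n+1}$; so the squared norm is the expectation of the square over $\tilde{\mathfrak Y}_{n+1}$ and $\tilde X$.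
   Formalization: The constant Γ is required to bound, almost surely, the simulated rewards Ĵ(n,m) for n=1..N, m=1..M, in addition to |V(n,x)|; this is automatic for Γ ≥ (N-1)‖f‖+‖g‖, and with a bound on V alone the claim fails. *)

theory Defs
  imports "HOL-Probability.Probability"
begin

section \<open>Controlled process and value function\<close>

definition unif01 :: "real measure" where
  "unif01 = restrict_space lborel {0..1}"

text \<open>State at time \<open>n + j\<close> when starting from \<open>x\<close> at time \<open>n\<close> and using the feedback
  policy \<open>pol\<close> and the noise \<open>\<xi>\<close>, both indexed by absolute time.\<close>

primrec traj ::
  "(nat \<Rightarrow> 'x \<Rightarrow> real \<Rightarrow> 'u \<Rightarrow> 'x) \<Rightarrow> (nat \<Rightarrow> 'x \<Rightarrow> 'u) \<Rightarrow> (nat \<Rightarrow> real) \<Rightarrow> nat \<Rightarrow> 'x \<Rightarrow> nat \<Rightarrow> 'x" where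
  "traj dyn pol \<xi> n x 0 = x"
| "traj dyn pol \<xi> n x (Suc j) =
     (let z = traj dyn pol \<xi> n x j in dyn (n + j) z (\<xi> (n + j)) (pol (n + j) z))"

definition path_reward ::
  "nat \<Rightarrow> (nat \<Rightarrow> 'x \<Rightarrow> real \<Rightarrow> 'u \<Rightarrow> 'x) \<Rightarrow> (nat \<Rightarrow> 'x \<Rightarrow> 'u \<Rightarrow> real) \<Rightarrow> ('x \<Rightarrow> real) \<Rightarrow>
   (nat \<Rightarrow> 'x \<Rightarrow> 'u) \<Rightarrow> (nat \<Rightarrow> real) \<Rightarrow> nat \<Rightarrow> 'x \<Rightarrow> real" where
  "path_reward N dyn f g pol \<xi> n x =
     (let X = (\<lambda>s. traj dyn pol \<xi> n x (s - n))
      in (\<Sum>s\<in>{n..<N}. f s (X s) (pol s (X s))) + g (X N))"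

definition policy_value ::
  "nat \<Rightarrow> (nat \<Rightarrow> 'x \<Rightarrow> real \<Rightarrow> 'u \<Rightarrow> 'x) \<Rightarrow> (nat \<Rightarrow> 'x \<Rightarrow> 'u \<Rightarrow> real) \<Rightarrow> ('x \<Rightarrow> real) \<Rightarrow>
   (nat \<Rightarrow> 'x \<Rightarrow> 'u) \<Rightarrow> nat \<Rightarrow> 'x \<Rightarrow> real" where
  "policy_value N dyn f g pol n x =
     (\<integral>\<xi>. path_reward N dyn f g pol \<xi> n x \<partial>PiM {..<N} (\<lambda>_. unif01))"

definition feedback_policies ::
  "nat \<Rightarrow> 'x::euclidean_space set \<Rightarrow> 'u::euclidean_space set \<Rightarrow> (nat \<Rightarrow> 'x \<Rightarrow> 'u) set" where
  "feedback_policies N D U =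
     {pol. \<forall>n<N. pol n \<in> restrict_space borel D \<rightarrow>\<^sub>M restrict_space borel U}"

definition value_fun ::
  "nat \<Rightarrow> 'x::euclidean_space set \<Rightarrow> 'u::euclidean_space set \<Rightarrow>
   (nat \<Rightarrow> 'x \<Rightarrow> real \<Rightarrow> 'u \<Rightarrow> 'x) \<Rightarrow> (nat \<Rightarrow> 'x \<Rightarrow> 'u \<Rightarrow> real) \<Rightarrow> ('x \<Rightarrow> real) \<Rightarrow> nat \<Rightarrow> 'x \<Rightarrow> real" where
  "value_fun N D U dyn f g n x =
     (SUP pol\<in>feedback_policies N D U. policy_value N dyn f g pol n x)"


section \<open>Square-integrable functions, projection, matrices\<close>

definition L2 :: "'a measure \<Rightarrow> ('a \<Rightarrow> real) set" where
  "L2 M = {h \<in> borel_measurable M. integrable M (\<lambda>x. (h x)\<^sup>2)}"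

definition L2_norm :: "'a measure \<Rightarrow> ('a \<Rightarrow> real) \<Rightarrow> real" where
  "L2_norm M h = sqrt (\<integral>x. (h x)\<^sup>2 \<partial>M)"

definition lincomb :: "('k::finite \<Rightarrow> 'a \<Rightarrow> real) \<Rightarrow> real ^ 'k \<Rightarrow> 'a \<Rightarrow> real" where
  "lincomb \<phi> a x = (\<Sum>k\<in>UNIV. a $ k * \<phi> k x)"

definition L2_independent :: "'a measure \<Rightarrow> ('k::finite \<Rightarrow> 'a \<Rightarrow> real) \<Rightarrow> bool" where
  "L2_independent M \<phi> \<longleftrightarrow> (\<forall>a. (AE x in M. lincomb \<phi> a x = 0) \<longrightarrow> a = 0)"

text \<open>Orthogonal projection of \<open>h\<close> onto the span of the \<open>\<phi> k\<close>; the element of the span is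
  unique when \<open>L2_independent M \<phi>\<close>.\<close>

definition L2_proj :: "'a measure \<Rightarrow> ('k::finite \<Rightarrow> 'a \<Rightarrow> real) \<Rightarrow> ('a \<Rightarrow> real) \<Rightarrow> 'a \<Rightarrow> real" where
  "L2_proj M \<phi> h =
     (SOME p. p \<in> range (lincomb \<phi>) \<and>
        (\<forall>q\<in>range (lincomb \<phi>). (\<integral>x. (h x - p x) * q x \<partial>M) = 0))"

definition gram :: "'a measure \<Rightarrow> ('k::finite \<Rightarrow> 'a \<Rightarrow> real) \<Rightarrow> real ^ 'k ^ 'k" where
  "gram M \<phi> = (\<chi> i j. \<integral>x. \<phi> i x * \<phi> j x \<partial>M)"

text \<open>For a symmetric positive definite \<open>A\<close> the matrix \<open>B\<close> below, that is \<open>A\<close> to the power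
  \<open>-1/2\<close>, exists and is unique.\<close>

definition inv_sqrt_matrix :: "real ^ 'k ^ 'k \<Rightarrow> real ^ 'k ^ 'k" where
  "inv_sqrt_matrix A =
     (SOME B. transpose B = B \<and> (\<forall>v. 0 \<le> v \<bullet> (B *v v)) \<and> B ** B = matrix_inv A)"

definition matrix_op_norm :: "real ^ 'k ^ 'k \<Rightarrow> real" where
  "matrix_op_norm B = onorm ((*v) B)"

definition usc_on :: "'a::topological_space set \<Rightarrow> ('a \<Rightarrow> real) \<Rightarrow> bool" where
  "usc_on S h \<longleftrightarrow> (\<forall>u\<in>S. \<forall>c>h u. eventually (\<lambda>v. h v < c) (at u within S))"


section \<open>Performance iteration\<close>

text \<open>A realisation of the simulation consists of the training points, indexed by \<open>(j, m)\<close>, and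
  of the noise, indexed by \<open>(j, m, s)\<close>: the noise moving at time \<open>s\<close> the \<open>m\<close>-th path that is
  started at time \<open>j\<close>. The law \<open>sim_law N M \<mu> n\<close> is that of the variables with \<open>j \<ge> n\<close>. For
  \<open>n > N\<close> both index sets are empty and it is a unit point mass.\<close>

type_synonym 'x sim = "(nat \<times> nat \<Rightarrow> 'x) \<times> (nat \<times> nat \<times> nat \<Rightarrow> real)"

definition point_idx :: "nat \<Rightarrow> nat \<Rightarrow> nat \<Rightarrow> (nat \<times> nat) set" where
  "point_idx N M n = {n..N} \<times> {1..M}"

definition noise_idx :: "nat \<Rightarrow> nat \<Rightarrow> nat \<Rightarrow> (nat \<times> nat \<times> nat) set" where
  "noise_idx N M n = (SIGMA j:{n..<N}. {1..M} \<times> {j..<N})"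

definition sim_law :: "nat \<Rightarrow> nat \<Rightarrow> 'x measure \<Rightarrow> nat \<Rightarrow> 'x sim measure" where
  "sim_law N M \<mu> n =
     PiM (point_idx N M n) (\<lambda>_. \<mu>) \<Otimes>\<^sub>M PiM (noise_idx N M n) (\<lambda>_. unif01)"

definition sim_from :: "nat \<Rightarrow> nat \<Rightarrow> nat \<Rightarrow> 'x sim \<Rightarrow> 'x sim" where
  "sim_from N M n y = (restrict (fst y) (point_idx N M n), restrict (snd y) (noise_idx N M n))"

definition basis_cond ::
  "'x measure \<Rightarrow> (nat \<Rightarrow> 'x \<Rightarrow> 'u \<Rightarrow> 'x \<Rightarrow> real) \<Rightarrow> ('k \<Rightarrow> 'x \<Rightarrow> real) \<Rightarrow>
   nat \<Rightarrow> 'k \<Rightarrow> 'x \<Rightarrow> 'u \<Rightarrow> real" where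
  "basis_cond \<mu> r \<phi> n k x u = (\<integral>y. \<phi> k y * r n x u y \<partial>\<mu>)"

text \<open>The estimated policy is a function \<open>uhat\<close> such that \<open>uhat n y\<close> is the feedback map at
  time \<open>n\<close> when \<open>y\<close> is the realisation of the simulation variables with \<open>j \<ge> n + 1\<close>.\<close>

definition sim_reward ::
  "nat \<Rightarrow> nat \<Rightarrow> (nat \<Rightarrow> 'x \<Rightarrow> real \<Rightarrow> 'u \<Rightarrow> 'x) \<Rightarrow> (nat \<Rightarrow> 'x \<Rightarrow> 'u \<Rightarrow> real) \<Rightarrow> ('x \<Rightarrow> real) \<Rightarrow>
   (nat \<Rightarrow> 'x sim \<Rightarrow> 'x \<Rightarrow> 'u) \<Rightarrow> nat \<Rightarrow> nat \<Rightarrow> 'x sim \<Rightarrow> real" where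
  "sim_reward N M dyn f g uhat n m y =
     path_reward N dyn f g (\<lambda>s. uhat s (sim_from N M (Suc s) y)) (\<lambda>s. snd y (n, m, s)) n
       (fst y (n, m))"

definition coeff_est ::
  "nat \<Rightarrow> nat \<Rightarrow> 'x measure \<Rightarrow> (nat \<Rightarrow> 'x \<Rightarrow> real \<Rightarrow> 'u \<Rightarrow> 'x) \<Rightarrow> (nat \<Rightarrow> 'x \<Rightarrow> 'u \<Rightarrow> real) \<Rightarrow>
   ('x \<Rightarrow> real) \<Rightarrow> ('k::finite \<Rightarrow> 'x \<Rightarrow> real) \<Rightarrow> (nat \<Rightarrow> 'x sim \<Rightarrow> 'x \<Rightarrow> 'u) \<Rightarrow>
   nat \<Rightarrow> 'x sim \<Rightarrow> real ^ 'k" where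
  "coeff_est N M \<mu> dyn f g \<phi> uhat n y =
     matrix_inv (gram \<mu> \<phi>) *v
       ((1 / real M) *\<^sub>R
          (\<Sum>m = 1..M. sim_reward N M dyn f g uhat n m y *\<^sub>R (\<chi> k. \<phi> k (fst y (n, m)))))"

definition performance_iteration ::
  "nat \<Rightarrow> nat \<Rightarrow> 'x measure \<Rightarrow> 'u::euclidean_space set \<Rightarrow> (nat \<Rightarrow> 'x \<Rightarrow> real \<Rightarrow> 'u \<Rightarrow> 'x) \<Rightarrow>
   (nat \<Rightarrow> 'x \<Rightarrow> 'u \<Rightarrow> 'x \<Rightarrow> real) \<Rightarrow> (nat \<Rightarrow> 'x \<Rightarrow> 'u \<Rightarrow> real) \<Rightarrow> ('x \<Rightarrow> real) \<Rightarrow>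
   ('k::finite \<Rightarrow> 'x \<Rightarrow> real) \<Rightarrow> (nat \<Rightarrow> 'x sim \<Rightarrow> 'x \<Rightarrow> 'u) \<Rightarrow> bool" where
  "performance_iteration N M \<mu> U dyn r f g \<phi> uhat \<longleftrightarrow>
     (\<forall>n<N.
        (\<lambda>(y, x). uhat n y x) \<in> sim_law N M \<mu> (Suc n) \<Otimes>\<^sub>M \<mu> \<rightarrow>\<^sub>M restrict_space borel U \<and>
        (\<forall>y\<in>space (sim_law N M \<mu> (Suc n)). \<forall>x\<in>space \<mu>.
           is_arg_max
             (\<lambda>u. f n x u + (\<Sum>k\<in>UNIV. coeff_est N M \<mu> dyn f g \<phi> uhat (Suc n) y $ k
                                        * basis_cond \<mu> r \<phi> n k x u))
             (\<lambda>u. u \<in> U) (uhat n y x)))"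

function est_policy_value ::
  "nat \<Rightarrow> nat \<Rightarrow> 'x measure \<Rightarrow> (nat \<Rightarrow> 'x \<Rightarrow> 'u \<Rightarrow> 'x \<Rightarrow> real) \<Rightarrow> (nat \<Rightarrow> 'x \<Rightarrow> 'u \<Rightarrow> real) \<Rightarrow>
   ('x \<Rightarrow> real) \<Rightarrow> (nat \<Rightarrow> 'x sim \<Rightarrow> 'x \<Rightarrow> 'u) \<Rightarrow> nat \<Rightarrow> 'x sim \<Rightarrow> 'x \<Rightarrow> real" where
  "est_policy_value N M \<mu> r f g uhat n y x =
     (if n < N
      then f n x (uhat n y x) +
           (\<integral>x'. est_policy_value N M \<mu> r f g uhat (Suc n) (sim_from N M (Suc (Suc n)) y) x'
                   * r n x (uhat n y x) x' \<partial>\<mu>)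
      else g x)"
  by pat_completeness auto
termination
  by (relation "Wellfounded.measure (\<lambda>(N, M, \<mu>, r, f, g, uhat, n, y, x). N - n)") auto

declare est_policy_value.simps [simp del]

end

theory Submission
  imports Defs
begin

text \<open>
  Let \<open>h = \<Sum>k. \<alpha>\<^sub>k \<phi>\<^sub>k\<close> be the regression estimate at time \<open>n + 1\<close>. Since the estimated policy
  is greedy for \<open>h\<close> and is itself admissible, the nonnegative difference \<open>V - V'\<close> of the value
  function and the estimated performance at time \<open>n\<close> is bounded, uniformly in the state, by
  \<open>R (\<parallel>V - h\<parallel> + \<parallel>h - V'\<parallel>)\<close> with norms at time \<open>n + 1\<close>: Cauchy-Schwarz with respect to the
  density \<open>r \<le> R\<^sup>2\<close>. Only the easy half of the Bellman equation (\<open>\<le>\<close>) enters, so no measurable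
  selection is needed. Now \<open>h\<close> estimates the projection of \<open>V'\<close>, not of \<open>V\<close>, without bias: the
  rewards collected along the simulated paths have conditional mean \<open>V'\<close>. Hence \<open>\<parallel>V - h\<parallel>\<close> is at most
  the projection error of \<open>V\<close>, plus \<open>\<parallel>V' - V\<parallel>\<close> because projections contract, plus a Monte Carlo
  error, which is a sum of \<open>M\<close> orthogonal terms. This gives the recursion
  \<open>e n \<le> 3 R e (n + 1) + 2 R c\<close> with \<open>e N = 0\<close>.
\<close>

section \<open>Square-integrable functions\<close>

text \<open>The Monte Carlo error is controlled by the second moment of the rewards realised along
  simulated paths. A bound on their conditional mean does not control that moment, so \<Gamma> has
  to bound the realised rewards almost surely; this is the content of \<open>Gamma_sim\<close>. The
  paths started at one time all use the same estimated policy and are therefore only conditionally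
  independent, given the variables of later times. Conditional expectations are avoided: one path is
  replaced by a fresh copy, the law of the simulation does not change, and both unbiasedness and
  orthogonality become identities between ordinary integrals. The estimated performance at time n
  depends on variables of times after n, while the regression at time n also reads those of time n
  itself. Norms over these two families are compared by dropping the surplus variables, which is a
  marginal of a product law.\<close>

lemma L2_measurable [measurable_dest]: "h \<in> L2 M \<Longrightarrow> h \<in> borel_measurable M"
  by (simp add: L2_def)

lemma L2_integrable_square: "h \<in> L2 M \<Longrightarrow> integrable M (\<lambda>x. (h x)\<^sup>2)"
  by (simp add: L2_def)

lemma L2_integrable_mult:
  assumes "f \<in> L2 M" "g \<in> L2 M"
  shows "integrable M (\<lambda>x. f x * g x)"
proof (rule Bochner_Integration.integrable_bound)
  show "integrable M (\<lambda>x. (f x)\<^sup>2 + (g x)\<^sup>2)"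
    using assms by (intro Bochner_Integration.integrable_add L2_integrable_square)
  show "(\<lambda>x. f x * g x) \<in> borel_measurable M"
    using assms by (auto simp: L2_def)
  have "\<bar>a * b\<bar> \<le> a\<^sup>2 + b\<^sup>2" for a b :: real
    using sum_squares_bound[of a b] sum_squares_bound[of a "- b"] by (auto simp: abs_if)
  then show "AE x in M. norm (f x * g x) \<le> norm ((f x)\<^sup>2 + (g x)\<^sup>2)" by simp
qed

lemma L2_add:
  assumes "f \<in> L2 M" "g \<in> L2 M"
  shows "(\<lambda>x. f x + g x) \<in> L2 M"
proof -
  have "integrable M (\<lambda>x. (f x)\<^sup>2 + (g x)\<^sup>2 + 2 * (f x * g x))"
    using assms
    by (intro Bochner_Integration.integrable_add L2_integrable_square integrable_mult_right
        L2_integrable_mult)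
  then show ?thesis
    using assms by (auto simp: L2_def power2_sum mult.assoc)
qed

lemma L2_scale:
  assumes "f \<in> L2 M"
  shows "(\<lambda>x. c * f x) \<in> L2 M"
  using assms by (auto simp: L2_def power_mult_distrib)

lemma L2_diff:
  assumes "f \<in> L2 M" "g \<in> L2 M"
  shows "(\<lambda>x. f x - g x) \<in> L2 M"
  using L2_add[OF assms(1) L2_scale[OF assms(2), of "- 1"]] by simp

lemma L2_zero: "(\<lambda>x. 0) \<in> L2 M"
  by (simp add: L2_def)

lemma L2_sum:
  assumes "\<And>i. i \<in> I \<Longrightarrow> f i \<in> L2 M"
  shows "(\<lambda>x. \<Sum>i\<in>I. f i x) \<in> L2 M"
  using assms by (induction I rule: infinite_finite_induct) (auto intro: L2_zero L2_add)

lemma L2_norm_nonneg: "0 \<le> L2_norm M h"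
  by (simp add: L2_norm_def)

lemma L2_norm_square: "(L2_norm M h)\<^sup>2 = (\<integral>x. (h x)\<^sup>2 \<partial>M)"
  by (simp add: L2_norm_def)

lemma L2_norm_minus: "L2_norm M (\<lambda>x. f x - g x) = L2_norm M (\<lambda>x. g x - f x)"
  by (simp add: L2_norm_def power2_commute)

lemma L2_norm_scale: "L2_norm M (\<lambda>x. c * f x) = \<bar>c\<bar> * L2_norm M f"
  by (simp add: L2_norm_def power_mult_distrib real_sqrt_mult)

lemma L2_norm_mono:
  assumes "g \<in> L2 M" "f \<in> borel_measurable M" "AE x in M. \<bar>f x\<bar> \<le> \<bar>g x\<bar>"
  shows "f \<in> L2 M" "L2_norm M f \<le> L2_norm M g"
proof -
  have *: "AE x in M. (f x)\<^sup>2 \<le> (g x)\<^sup>2"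
    using assms(3) by (auto simp: abs_le_square_iff)
  have i: "integrable M (\<lambda>x. (f x)\<^sup>2)"
    using * assms
    by (intro Bochner_Integration.integrable_bound[OF L2_integrable_square[OF assms(1)]]) auto
  then show "f \<in> L2 M" using assms by (simp add: L2_def)
  show "L2_norm M f \<le> L2_norm M g"
    unfolding L2_norm_def
    using integral_mono_AE[OF i L2_integrable_square[OF assms(1)] *] by simp
qed

text \<open>The integral of the square of \<open>t * f - g\<close> is a nonnegative quadratic in t;
  its value at the minimiser \<open>t = c / a\<^sup>2\<close> is the inequality.\<close>

lemma L2_Cauchy_Schwarz:
  assumes f: "f \<in> L2 M" and g: "g \<in> L2 M"
  shows "(\<integral>x. f x * g x \<partial>M) \<le> L2_norm M f * L2_norm M g"
proof -
  define a b c where "a = L2_norm M f" and "b = L2_norm M g" and "c = (\<integral>x. f x * g x \<partial>M)"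
  have ge: "0 \<le> t\<^sup>2 * a\<^sup>2 + b\<^sup>2 - 2 * t * c" for t
  proof -
    have "0 \<le> (\<integral>x. (t * f x - g x)\<^sup>2 \<partial>M)" by simp
    also have "\<dots> = (\<integral>x. t\<^sup>2 * (f x)\<^sup>2 + (g x)\<^sup>2 - 2 * t * (f x * g x) \<partial>M)"
      by (intro Bochner_Integration.integral_cong) (auto simp: power2_diff power_mult_distrib)
    also have "\<dots> = t\<^sup>2 * a\<^sup>2 + b\<^sup>2 - 2 * t * c"
      using L2_integrable_square[OF f] L2_integrable_square[OF g] L2_integrable_mult[OF f g]
      by (simp add: a_def b_def c_def L2_norm_square)
    finally show ?thesis .
  qed
  have nn: "0 \<le> a" "0 \<le> b" by (auto simp: a_def b_def L2_norm_nonneg)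
  have "c \<le> a * b"
  proof (cases "a = 0")
    case True
    show ?thesis
    proof (rule ccontr)
      assume "\<not> c \<le> a * b"
      then have "c > 0" using True by simp
      \<comment> \<open>For a = 0 the quadratic is affine in t. The chosen t gives it the value
        -1.\<close>
      then show False using ge[of "(b\<^sup>2 + 1) / (2 * c)"] True by (simp add: field_simps)
    qed
  next
    case False
    then have "a > 0" using nn by simp
    have "(c / a\<^sup>2)\<^sup>2 * a\<^sup>2 = c\<^sup>2 / a\<^sup>2" "2 * (c / a\<^sup>2) * c = 2 * (c\<^sup>2 / a\<^sup>2)"
      using \<open>a > 0\<close> by (simp_all add: power2_eq_square)
    then have "c\<^sup>2 / a\<^sup>2 \<le> b\<^sup>2" using ge[of "c / a\<^sup>2"] by linarith
    then have "c\<^sup>2 \<le> (a * b)\<^sup>2"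
      using \<open>a > 0\<close> by (simp add: pos_divide_le_eq power_mult_distrib mult.commute)
    then show ?thesis using nn by (auto intro: power2_le_imp_le)
  qed
  then show ?thesis by (simp add: a_def b_def c_def)
qed

lemma L2_norm_triangle:
  assumes f: "f \<in> L2 M" and g: "g \<in> L2 M"
  shows "L2_norm M (\<lambda>x. f x + g x) \<le> L2_norm M f + L2_norm M g"
proof -
  have "(L2_norm M (\<lambda>x. f x + g x))\<^sup>2 = (\<integral>x. (f x)\<^sup>2 + (g x)\<^sup>2 + 2 * (f x * g x) \<partial>M)"
    by (simp add: L2_norm_square power2_sum mult.assoc)
  also have "\<dots> = (L2_norm M f)\<^sup>2 + (L2_norm M g)\<^sup>2 + 2 * (\<integral>x. f x * g x \<partial>M)"
    using L2_integrable_square[OF f] L2_integrable_square[OF g] L2_integrable_mult[OF f g]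
    by (simp add: L2_norm_square)
  also have "\<dots> \<le> (L2_norm M f + L2_norm M g)\<^sup>2"
    using L2_Cauchy_Schwarz[OF f g] by (simp add: power2_sum)
  finally show ?thesis
    by (rule power2_le_imp_le) (simp add: L2_norm_nonneg)
qed

lemma (in prob_space) L2_bounded:
  assumes "h \<in> borel_measurable M" "AE x in M. \<bar>h x\<bar> \<le> B"
  shows "h \<in> L2 M"
proof -
  have B: "(\<lambda>x. B) \<in> L2 M" by (simp add: L2_def)
  have le: "AE x in M. \<bar>h x\<bar> \<le> \<bar>B\<bar>" using assms(2) by eventually_elim simp
  show ?thesis by (rule L2_norm_mono(1)[OF B assms(1) le])
qed

lemma (in prob_space) L2_integrable:
  assumes "h \<in> L2 M"
  shows "integrable M h"
proof -
  have "(\<lambda>x. 1) \<in> L2 M" by (simp add: L2_def)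
  from L2_integrable_mult[OF assms this] show ?thesis by simp
qed

text \<open>Change of variables. With a projection or restriction as \<open>T\<close>, a function of
  some of the variables has the same norm on the larger space as on its own.\<close>

lemma L2_distr:
  assumes T: "T \<in> M \<rightarrow>\<^sub>M M'" and d: "distr M M' T = M'" and h: "h \<in> L2 M'"
  shows "(\<lambda>x. h (T x)) \<in> L2 M" "L2_norm M (\<lambda>x. h (T x)) = L2_norm M' h"
proof -
  have m: "(\<lambda>x. (h x)\<^sup>2) \<in> borel_measurable M'" using h by (auto simp: L2_def)
  have "integrable (distr M M' T) (\<lambda>x. (h x)\<^sup>2)" using h d by (simp add: L2_def)
  then have "integrable M (\<lambda>x. (h (T x))\<^sup>2)"
    by (simp add: integrable_distr_eq[OF T m])
  then show "(\<lambda>x. h (T x)) \<in> L2 M"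
    using h T by (auto simp: L2_def)
  show "L2_norm M (\<lambda>x. h (T x)) = L2_norm M' h"
    unfolding L2_norm_def integral_distr[OF T m, symmetric] d ..
qed

text \<open>Fubini for the square. Bounds obtained with the simulation frozen involve norms in the
  state only; this turns them into joint norms.\<close>

lemma (in pair_prob_space) L2_norm_pair:
  assumes "(\<lambda>(x, y). h x y) \<in> L2 (M1 \<Otimes>\<^sub>M M2)" "\<And>x. x \<in> space M1 \<Longrightarrow> h x \<in> L2 M2"
  shows "(\<lambda>x. L2_norm M2 (h x)) \<in> L2 M1"
    and "L2_norm M1 (\<lambda>x. L2_norm M2 (h x)) = L2_norm (M1 \<Otimes>\<^sub>M M2) (\<lambda>(x, y). h x y)"
proof -
  have i: "integrable (M1 \<Otimes>\<^sub>M M2) (\<lambda>p. (h (fst p) (snd p))\<^sup>2)"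
    using L2_integrable_square[OF assms(1)] by (simp add: split_beta')
  have m: "(\<lambda>(x, y). h x y) \<in> borel_measurable (M1 \<Otimes>\<^sub>M M2)" using assms(1) by (rule L2_measurable)
  have "(\<lambda>x. \<integral>y. (h x y)\<^sup>2 \<partial>M2) \<in> borel_measurable M1"
    using m by (intro M2.borel_measurable_lebesgue_integral) (simp add: split_beta')
  then have "(\<lambda>x. L2_norm M2 (h x)) \<in> borel_measurable M1" by (simp add: L2_norm_def)
  then show "(\<lambda>x. L2_norm M2 (h x)) \<in> L2 M1"
    using integrable_fst'[OF i] by (simp add: L2_def L2_norm_square)
  show "L2_norm M1 (\<lambda>x. L2_norm M2 (h x)) = L2_norm (M1 \<Otimes>\<^sub>M M2) (\<lambda>(x, y). h x y)"
    unfolding L2_norm_def[of M1] L2_norm_square using integral_fst'[OF i]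
    by (simp add: L2_norm_def split_beta')
qed

section \<open>Square roots of matrices and projections\<close>

lemma all_inner_eq_zero_iff: "(\<forall>b. b \<bullet> v = 0) \<longleftrightarrow> v = 0"
  using inner_eq_zero_iff[of v] by (metis inner_zero_right)

lemma matrix_inv_mult:
  fixes A :: "real^'n^'n"
  assumes "invertible A"
  shows "A ** matrix_inv A = mat 1" "matrix_inv A ** A = mat 1"
  using someI_ex[OF assms[unfolded invertible_def]] by (simp_all add: matrix_inv_def)

lemma lincomb_diff: "lincomb \<phi> (a - b) x = lincomb \<phi> a x - lincomb \<phi> b x"
  by (simp add: lincomb_def algebra_simps sum_subtractf)

lemma gram_symmetric: "transpose (gram M \<phi>) = gram M \<phi>"
  by (simp add: gram_def transpose_def vec_eq_iff mult.commute)

text \<open>Moving from \<open>v\<close> along the residual \<open>w = T v - c v\<close> gains 2 t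
  |w|^2 to first order and changes the rest only by order t^2. Maximality therefore forces
  \<open>w = 0\<close>. Invariance of \<open>S\<close> keeps \<open>w\<close> among the admissible
  directions.\<close>

lemma Rayleigh_maximiser_eigenvector:
  fixes T :: "'a::real_inner \<Rightarrow> 'a"
  assumes lin: "linear T" and sa: "\<And>x y. T x \<bullet> y = x \<bullet> T y"
    and S: "subspace S" "T ` S \<subseteq> S" "v \<in> S" "norm v = 1"
    and max: "\<And>x. x \<in> S \<Longrightarrow> norm x = 1 \<Longrightarrow> x \<bullet> T x \<le> v \<bullet> T v"
  shows "T v = (v \<bullet> T v) *\<^sub>R v"
proof -
  define c where "c = v \<bullet> T v"
  define w where "w = T v - c *\<^sub>R v"
  have wS: "w \<in> S" unfolding w_def using S by (auto intro: subspace_diff subspace_scale)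
  \<comment> \<open>Homogeneity removes the constraint \<open>norm x = 1\<close>, so the perturbed
    vector need not be renormalised.\<close>
  have hom: "x \<bullet> T x \<le> c * (x \<bullet> x)" if "x \<in> S" for x
  proof (cases "x = 0")
    case False
    have "(x /\<^sub>R norm x) \<bullet> T (x /\<^sub>R norm x) \<le> c"
      unfolding c_def using False that S by (intro max) (auto intro: subspace_scale)
    then show ?thesis
      using False by (simp add: linear_cmul[OF lin] field_simps power2_norm_eq_inner[symmetric] power2_eq_square)
  qed (simp add: linear_0[OF lin])
  define b where "b = c * (w \<bullet> w) - w \<bullet> T w"
  have le: "2 * t * (w \<bullet> w) \<le> t\<^sup>2 * b" for t
  proof -
    have "(v + t *\<^sub>R w) \<bullet> T (v + t *\<^sub>R w) \<le> c * ((v + t *\<^sub>R w) \<bullet> (v + t *\<^sub>R w))"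
      using S wS by (intro hom) (auto intro: subspace_add subspace_scale)
    moreover have "v \<bullet> T w = w \<bullet> T v" using sa[of v w] by (simp add: inner_commute)
    moreover have "v \<bullet> v = 1" using S by (simp add: norm_eq_1)
    moreover have "w \<bullet> T v = w \<bullet> w + c * (v \<bullet> w)"
    proof -
      have "T v = w + c *\<^sub>R v" by (simp add: w_def)
      then show ?thesis by (simp add: inner_add_right inner_commute)
    qed
    ultimately show ?thesis
      by (simp add: linear_add[OF lin] linear_cmul[OF lin] inner_add_left inner_add_right b_def
          c_def[symmetric] inner_commute[of w v] algebra_simps power2_eq_square)
  qed
  have "w \<bullet> w \<le> 0"
  proof (rule ccontr)
    assume n: "\<not> w \<bullet> w \<le> 0"
    show False
    proof -
      have "b > 0" using le[of 1] n by simp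
      then have "(w \<bullet> w) * (w \<bullet> w) \<le> 0"
        using le[of "(w \<bullet> w) / b"] by (simp add: field_simps power2_eq_square)
      then show False using n by (simp add: mult_le_0_iff)
    qed
  qed
  then have "w = 0" by (metis inner_eq_zero_iff inner_ge_zero order_antisym)
  then show ?thesis by (simp add: w_def c_def)
qed

text \<open>Compactness of the unit sphere of \<open>S\<close> yields an eigenvector, and
  self-adjointness makes its orthogonal complement within \<open>S\<close> invariant again.
  Arbitrary invariant subspaces are allowed so that the induction on the dimension can pass to that
  complement.\<close>

lemma selfadjoint_eigenbasis:
  fixes T :: "'a::euclidean_space \<Rightarrow> 'a"
  assumes lin: "linear T" and sa: "\<And>x y. T x \<bullet> y = x \<bullet> T y"
    and S: "subspace S" "T ` S \<subseteq> S"
  shows "\<exists>E. finite E \<and> pairwise orthogonal E \<and> (\<forall>e\<in>E. norm e = 1 \<and> T e = (e \<bullet> T e) *\<^sub>R e)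
    \<and> span E = S"
  using S
proof (induction "dim S" arbitrary: S rule: less_induct)
  case less
  show ?case
  proof (cases "S = {0}")
    case True
    then show ?thesis by (intro exI[of _ "{}"]) auto
  next
    case False
    let ?K = "sphere 0 1 \<inter> S"
    obtain z where "z \<in> S" "z \<noteq> 0" using False less.prems subspace_0 by blast
    then have "z /\<^sub>R norm z \<in> ?K" using less.prems by (auto intro: subspace_scale)
    then have ne: "?K \<noteq> {}" by blast
    have "compact ?K" by (intro compact_Int_closed closed_subspace less.prems compact_sphere)
    moreover have "continuous_on ?K (\<lambda>x. x \<bullet> T x)"
      by (intro continuous_intros linear_continuous_on linear_linear[THEN iffD2] lin)
    ultimately obtain v where v: "v \<in> ?K" "\<And>x. x \<in> ?K \<Longrightarrow> x \<bullet> T x \<le> v \<bullet> T v"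
      using continuous_attains_sup[OF _ ne] by metis
    have ev: "T v = (v \<bullet> T v) *\<^sub>R v"
      using v less.prems
      by (intro Rayleigh_maximiser_eigenvector[OF lin sa, of S]) (auto simp: image_subset_iff)
    define S' where "S' = S \<inter> {x. v \<bullet> x = 0}"
    have S': "subspace S'" unfolding S'_def
      by (intro subspace_inter less.prems subspace_hyperplane)
    have TS': "T ` S' \<subseteq> S'"
    proof safe
      fix x assume "x \<in> S'"
      moreover have "v \<bullet> T x = (v \<bullet> T v) * (v \<bullet> x)" using sa[of v x] ev by (metis inner_scaleR_left)
      ultimately show "T x \<in> S'" using less.prems by (auto simp: S'_def)
    qed
    have "v \<notin> S'" using v(1) by (auto simp: S'_def)
    moreover have "v \<in> S" "S' \<subseteq> S" using v(1) by (auto simp: S'_def)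
    ultimately have "S' \<subset> S" by blast
    then have "dim S' < dim S"
      using S' less.prems by (intro dim_psubset) (simp add: span_eq_iff[THEN iffD2])
    from less.hyps[OF this S' TS'] obtain E where E: "finite E" "pairwise orthogonal E"
      "\<forall>e\<in>E. norm e = 1 \<and> T e = (e \<bullet> T e) *\<^sub>R e" "span E = S'" by blast
    have vE: "v \<bullet> e = 0" if "e \<in> E" for e
      using E(4) that span_base[of e E] by (auto simp: S'_def)
    have "span (insert v E) = S"
    proof
      show "span (insert v E) \<subseteq> S"
        using E(4) span_superset[of E] v(1) less.prems
        by (intro span_minimal) (auto simp: S'_def)
      show "S \<subseteq> span (insert v E)"
      proof
        fix x assume "x \<in> S"
        have "v \<bullet> v = 1" using v(1) by (simp add: norm_eq_1)
        then have "x - (v \<bullet> x) *\<^sub>R v \<in> span E"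
          unfolding E(4) S'_def using v(1) \<open>x \<in> S\<close> less.prems
          by (auto intro: subspace_diff subspace_scale simp: inner_diff_right)
        then show "x \<in> span (insert v E)" by (auto simp: span_insert)
      qed
    qed
    moreover have "pairwise orthogonal (insert v E)"
      using E(2) vE by (auto simp: pairwise_insert orthogonal_def inner_commute)
    ultimately show ?thesis
      using E(1,3) ev v(1) by (intro exI[of _ "insert v E"]) auto
  qed
qed

text \<open>In an orthonormal eigenbasis it suffices to take the root of each eigenvalue; for a unit
  eigenvector e the eigenvalue is e . (A e). Existence gives meaning to the choice made in
  \<open>inv_sqrt_matrix\<close>.\<close>

lemma psd_square_root_exists:
  fixes A :: "real^'n^'n"
  assumes sym: "transpose A = A" and psd: "\<And>v. 0 \<le> v \<bullet> (A *v v)"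
  shows "\<exists>B. transpose B = B \<and> (\<forall>v. 0 \<le> v \<bullet> (B *v v)) \<and> B ** B = A"
proof -
  have sa: "(A *v x) \<bullet> y = x \<bullet> (A *v y)" for x y
    using dot_lmul_matrix[of x A y] transpose_matrix_vector[of A x] sym by simp
  obtain E where E: "finite E" "pairwise orthogonal E"
    "\<And>e. e \<in> E \<Longrightarrow> norm e = 1" "\<And>e. e \<in> E \<Longrightarrow> A *v e = (e \<bullet> (A *v e)) *\<^sub>R e" "span E = UNIV"
    using selfadjoint_eigenbasis[of "(*v) A" UNIV] sa by auto
  define T where "T x = (\<Sum>e\<in>E. (sqrt (e \<bullet> (A *v e)) * (e \<bullet> x)) *\<^sub>R e)" for x
  have lin: "linear T"
    unfolding T_def
    by (intro linearI) (simp_all add: inner_add_right algebra_simps sum.distrib scaleR_sum_right)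
  have Te: "T e = sqrt (e \<bullet> (A *v e)) *\<^sub>R e" if "e \<in> E" for e
  proof -
    have "T e = (\<Sum>d\<in>E. if d = e then sqrt (e \<bullet> (A *v e)) *\<^sub>R e else 0)"
      unfolding T_def using E(2,3) that
      by (intro sum.cong) (auto simp: pairwise_def orthogonal_def norm_eq_1)
    then show ?thesis using E(1) that by simp
  qed
  have Tsa: "T x \<bullet> y = x \<bullet> T y" for x y
    by (simp add: T_def inner_sum_left inner_sum_right mult_ac inner_commute)
  have TT: "T (T x) = A *v x" for x
  proof (rule linear_eq_on_span[of "T \<circ> T" "(*v) A" E, simplified o_def])
    show "linear (\<lambda>x. T (T x))" using linear_compose[OF lin lin] by (simp add: o_def)
    fix e assume "e \<in> E"
    then show "T (T e) = A *v e"
      using psd[of e] E(4)[of e]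
      by (simp add: Te linear_cmul[OF lin])
  qed (use E(5) in auto)
  have Tpsd: "0 \<le> x \<bullet> T x" for x
    by (auto simp: T_def inner_sum_right inner_commute[of x] power2_eq_square[symmetric] mult.assoc
        intro!: sum_nonneg mult_nonneg_nonneg psd)
  let ?B = "matrix T"
  have B: "?B *v x = T x" for x by (simp add: matrix_works lin)
  have "(transpose ?B *v x) \<bullet> y = (?B *v x) \<bullet> y" for x y
    by (simp add: dot_lmul_matrix B Tsa)
  then have "transpose ?B = ?B"
    unfolding matrix_eq by (metis vector_eq_rdot)
  moreover have "?B ** ?B = A"
    by (simp add: matrix_eq matrix_vector_mul_assoc[symmetric] B TT)
  ultimately show ?thesis using B Tpsd by metis
qed

section \<open>Least squares in the span of the basis functions\<close>

locale L2_basis =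
  fixes M :: "'a measure" and \<phi> :: "'k::finite \<Rightarrow> 'a \<Rightarrow> real"
  assumes L: "\<And>k. \<phi> k \<in> L2 M" and ind: "L2_independent M \<phi>"
begin

lemma lincomb_L2: "lincomb \<phi> a \<in> L2 M"
  using L2_sum[of UNIV "\<lambda>k x. a $ k * \<phi> k x" M] L2_scale[OF L]
  by (simp add: lincomb_def[abs_def])

lemma integral_lincomb_mult:
  assumes h: "h \<in> L2 M"
  shows "(\<integral>x. lincomb \<phi> a x * h x \<partial>M) = a \<bullet> (\<chi> k. \<integral>x. h x * \<phi> k x \<partial>M)"
proof -
  have "(\<integral>x. lincomb \<phi> a x * h x \<partial>M) = (\<integral>x. (\<Sum>k\<in>UNIV. a $ k * (h x * \<phi> k x)) \<partial>M)"
    by (intro Bochner_Integration.integral_cong) (simp_all add: lincomb_def sum_distrib_left mult_ac)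
  also have "\<dots> = (\<Sum>k\<in>UNIV. a $ k * (\<integral>x. h x * \<phi> k x \<partial>M))"
    using L2_integrable_mult[OF h L] by simp
  finally show ?thesis by (simp add: inner_vec_def)
qed

lemma gram_mult_vec: "gram M \<phi> *v a = (\<chi> k. \<integral>x. lincomb \<phi> a x * \<phi> k x \<partial>M)"
proof -
  have "(gram M \<phi> *v a) $ i = (\<integral>x. lincomb \<phi> a x * \<phi> i x \<partial>M)" for i
    unfolding integral_lincomb_mult[OF L]
    by (simp add: gram_def matrix_vector_mult_def inner_vec_def mult.commute)
  then show ?thesis by (simp add: vec_eq_iff)
qed

lemma integral_lincomb_square: "(\<integral>x. (lincomb \<phi> a x)\<^sup>2 \<partial>M) = a \<bullet> (gram M \<phi> *v a)"
  using integral_lincomb_mult[OF lincomb_L2, of a a]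
  unfolding gram_mult_vec power2_eq_square .

lemma gram_pos_def:
  assumes "a \<bullet> (gram M \<phi> *v a) = 0"
  shows "a = 0"
proof -
  have "integrable M (\<lambda>x. (lincomb \<phi> a x)\<^sup>2)"
    by (rule L2_integrable_square[OF lincomb_L2])
  moreover have "(\<integral>x. (lincomb \<phi> a x)\<^sup>2 \<partial>M) = 0"
    using integral_lincomb_square assms by simp
  ultimately have "AE x in M. (lincomb \<phi> a x)\<^sup>2 = 0"
    by (subst (asm) integral_nonneg_eq_0_iff_AE) auto
  then show ?thesis using ind by (auto simp: L2_independent_def)
qed

lemma gram_invertible: "invertible (gram M \<phi>)"
  using gram_pos_def by (auto simp: invertible_left_inverse matrix_left_invertible_ker)

lemma gram_inverse_mult_vec: "gram M \<phi> *v (matrix_inv (gram M \<phi>) *v x) = x"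
  by (simp add: matrix_vector_mul_assoc matrix_inv_mult[OF gram_invertible])

text \<open>Orthogonality to the span amounts to the normal equations, whose matrix is the
  invertible Gram matrix. Their unique solution determines the chosen element as a function, not
  merely almost everywhere. The formula is that of the regression coefficients with an integral in
  place of the sample mean.\<close>

lemma L2_proj_eq:
  assumes h: "h \<in> L2 M"
  shows "L2_proj M \<phi> h = lincomb \<phi> (matrix_inv (gram M \<phi>) *v (\<chi> k. \<integral>x. h x * \<phi> k x \<partial>M))"
proof -
  let ?c = "\<lambda>h. (\<chi> k. \<integral>x. h x * \<phi> k x \<partial>M) :: real ^ 'k"
  let ?A = "gram M \<phi>"
  have inv: "invertible ?A" by (rule gram_invertible)
  have orth: "(\<forall>q\<in>range (lincomb \<phi>). (\<integral>x. (h x - lincomb \<phi> a x) * q x \<partial>M) = 0) \<longleftrightarrow> ?A *v a = ?c h"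
    for a
  proof -
    have *: "(\<integral>x. (h x - lincomb \<phi> a x) * lincomb \<phi> b x \<partial>M) = b \<bullet> (?c h - ?A *v a)" for b
    proof -
      have "(\<integral>x. (h x - lincomb \<phi> a x) * lincomb \<phi> b x \<partial>M)
          = (\<integral>x. lincomb \<phi> b x * h x - lincomb \<phi> b x * lincomb \<phi> a x \<partial>M)"
        by (simp add: algebra_simps)
      also have "\<dots> = b \<bullet> ?c h - b \<bullet> ?c (lincomb \<phi> a)"
        using L2_integrable_mult[OF lincomb_L2 h]
          L2_integrable_mult[OF lincomb_L2 lincomb_L2]
        by (simp add: integral_lincomb_mult h lincomb_L2)
      finally show ?thesis by (simp add: gram_mult_vec inner_diff_right)
    qed
    have "(\<forall>q\<in>range (lincomb \<phi>). (\<integral>x. (h x - lincomb \<phi> a x) * q x \<partial>M) = 0)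
        \<longleftrightarrow> (\<forall>b. b \<bullet> (?c h - ?A *v a) = 0)"
      unfolding *[symmetric] by blast
    also have "\<dots> \<longleftrightarrow> ?c h - ?A *v a = 0"
      by (rule all_inner_eq_zero_iff)
    also have "\<dots> \<longleftrightarrow> ?A *v a = ?c h" by auto
    finally show ?thesis .
  qed
  show ?thesis unfolding L2_proj_def
  proof (rule some_equality)
    show "lincomb \<phi> (matrix_inv ?A *v ?c h) \<in> range (lincomb \<phi>) \<and>
      (\<forall>q\<in>range (lincomb \<phi>).
        (\<integral>x. (h x - lincomb \<phi> (matrix_inv ?A *v ?c h) x) * q x \<partial>M) = 0)"
      unfolding orth by (simp add: gram_inverse_mult_vec)
  next
    fix p assume p: "p \<in> range (lincomb \<phi>) \<and>
      (\<forall>q\<in>range (lincomb \<phi>). (\<integral>x. (h x - p x) * q x \<partial>M) = 0)"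
    then obtain a where a: "p = lincomb \<phi> a" by auto
    then have "?A *v a = ?c h" using p orth by metis
    then show "p = lincomb \<phi> (matrix_inv ?A *v ?c h)"
      using a matrix_inv_mult(2)[OF inv] by (metis matrix_vector_mul_assoc matrix_vector_mul_lid)
  qed
qed

lemma L2_proj_diff:
  assumes f: "f \<in> L2 M" and g: "g \<in> L2 M"
  shows "L2_proj M \<phi> f x - L2_proj M \<phi> g x = L2_proj M \<phi> (\<lambda>x. f x - g x) x"
proof -
  have "(\<chi> k. \<integral>x. (f x - g x) * \<phi> k x \<partial>M)
      = (\<chi> k. \<integral>x. f x * \<phi> k x \<partial>M) - (\<chi> k. \<integral>x. g x * \<phi> k x \<partial>M)"
    using L2_integrable_mult[OF f L] L2_integrable_mult[OF g L]
    by (simp add: vec_eq_iff left_diff_distrib)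
  then show ?thesis
    using f g
    by (simp add: L2_proj_eq L2_diff matrix_vector_mult_diff_distrib lincomb_diff)
qed

text \<open>The projection p of h satisfies |p|^2 = <p, h>, and Cauchy-Schwarz allows one factor |p|
  to be cancelled.\<close>

lemma L2_proj_norm_le:
  assumes h: "h \<in> L2 M"
  shows "L2_norm M (L2_proj M \<phi> h) \<le> L2_norm M h"
proof -
  let ?a = "matrix_inv (gram M \<phi>) *v (\<chi> k. \<integral>x. h x * \<phi> k x \<partial>M)"
  let ?p = "lincomb \<phi> ?a"
  have p: "L2_proj M \<phi> h = ?p" by (rule L2_proj_eq[OF assms])
  have "(L2_norm M ?p)\<^sup>2 = ?a \<bullet> (gram M \<phi> *v ?a)"
    by (simp add: L2_norm_square integral_lincomb_square)
  also have "\<dots> = (\<integral>x. ?p x * h x \<partial>M)"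
    by (simp add: gram_inverse_mult_vec integral_lincomb_mult[OF h])
  also have "\<dots> \<le> L2_norm M ?p * L2_norm M h"
    by (rule L2_Cauchy_Schwarz[OF lincomb_L2 h])
  finally show ?thesis
    unfolding p power2_eq_square using L2_norm_nonneg[of M ?p] L2_norm_nonneg[of M h]
    by (cases "L2_norm M ?p = 0") auto
qed

text \<open>The quadratic form of the inverse Gram matrix at v is the squared norm of the
  combination with coefficients A^-1 v. The inverse is thus positive semidefinite and symmetric, so
  the root chosen in the definition exists.\<close>

lemma inv_sqrt_matrix_gram:
  shows "transpose (inv_sqrt_matrix (gram M \<phi>)) = inv_sqrt_matrix (gram M \<phi>)"
    and "inv_sqrt_matrix (gram M \<phi>) ** inv_sqrt_matrix (gram M \<phi>) = matrix_inv (gram M \<phi>)"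
proof -
  let ?A = "gram M \<phi>"
  have inv: "invertible ?A" by (rule gram_invertible)
  have sym: "transpose (matrix_inv ?A) = matrix_inv ?A"
  proof -
    have "transpose (matrix_inv ?A) ** ?A = mat 1"
      using arg_cong[OF matrix_inv_mult(1)[OF inv], of transpose]
      by (simp add: matrix_transpose_mul gram_symmetric transpose_mat)
    then have "transpose (matrix_inv ?A) ** (?A ** matrix_inv ?A) = matrix_inv ?A"
      by (simp add: matrix_mul_assoc)
    then show ?thesis by (simp add: matrix_inv_mult[OF inv])
  qed
  have "0 \<le> v \<bullet> (matrix_inv ?A *v v)" for v
  proof -
    have "v \<bullet> (matrix_inv ?A *v v) = (matrix_inv ?A *v v) \<bullet> (?A *v (matrix_inv ?A *v v))"
      by (simp add: gram_inverse_mult_vec inner_commute)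
    also have "\<dots> = (\<integral>x. (lincomb \<phi> (matrix_inv ?A *v v) x)\<^sup>2 \<partial>M)"
      by (simp add: integral_lincomb_square)
    finally show ?thesis by simp
  qed
  from someI_ex[OF psd_square_root_exists[OF sym this]]
  show "transpose (inv_sqrt_matrix ?A) = inv_sqrt_matrix ?A"
    and "inv_sqrt_matrix ?A ** inv_sqrt_matrix ?A = matrix_inv ?A"
    unfolding inv_sqrt_matrix_def by auto
qed

text \<open>The combination with coefficients A^-1 w has squared norm w . A^-1 w = |A^-1/2 w|^2.
  Regression multiplies the noise by A^-1, but one of its two roots is absorbed by the norm of the
  function space; this is why the theorem contains A^-1/2.\<close>

lemma lincomb_inv_gram_norm_le: "L2_norm M (lincomb \<phi> (matrix_inv (gram M \<phi>) *v w))
    \<le> matrix_op_norm (inv_sqrt_matrix (gram M \<phi>)) * norm w"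
proof -
  let ?B = "inv_sqrt_matrix (gram M \<phi>)"
  note B = inv_sqrt_matrix_gram
  have "(\<integral>x. (lincomb \<phi> (matrix_inv (gram M \<phi>) *v w) x)\<^sup>2 \<partial>M) = w \<bullet> (?B *v (?B *v w))"
    unfolding integral_lincomb_square
    by (simp only: gram_inverse_mult_vec matrix_vector_mul_assoc[of ?B] B(2) inner_commute)
  also have "\<dots> = (?B *v w) \<bullet> (?B *v w)"
    using dot_lmul_matrix[of w ?B "?B *v w"] transpose_matrix_vector[of ?B w] B(1) by simp
  finally have "L2_norm M (lincomb \<phi> (matrix_inv (gram M \<phi>) *v w)) = norm (?B *v w)"
    by (simp add: L2_norm_def norm_eq_sqrt_inner)
  then show ?thesis
    by (simp add: matrix_op_norm_def onorm)
qed

end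

section \<open>Resampling one block of the simulation\<close>

lemma prob_space_unif01: "prob_space unif01"
  unfolding unif01_def by (rule prob_spaceI) (simp add: emeasure_restrict_space space_restrict_space)

text \<open>On boxes, the constraint on coordinate \<open>i\<close> moves to the fresh factor while
  the old coordinate integrates out.\<close>

lemma distr_PiM_update:
  assumes M: "prob_space M" and I: "finite I" "i \<in> I"
  shows "distr (PiM I (\<lambda>_. M) \<Otimes>\<^sub>M M) (PiM I (\<lambda>_. M)) (\<lambda>(a, x). a(i := x)) = PiM I (\<lambda>_. M)"
proof -
  interpret M: prob_space M by fact
  interpret P: product_sigma_finite "\<lambda>_. M" by standard
  have ins: "insert i I = I" using I by auto
  have m[measurable]: "(\<lambda>(a, x). a(i := x)) \<in> PiM I (\<lambda>_. M) \<Otimes>\<^sub>M M \<rightarrow>\<^sub>M PiM I (\<lambda>_. M)"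
    using measurable_add_dim[of i I "\<lambda>_. M"] unfolding ins .
  show ?thesis
  proof (rule P.PiM_eqI[OF I(1)])
    fix A assume A: "\<And>j. j \<in> I \<Longrightarrow> A j \<in> sets M"
    let ?A = "\<lambda>j. if j = i then space M else A j"
    have sub: "A j \<subseteq> space M" if "j \<in> I" for j using A[OF that] by (rule sets.sets_into_space)
    have eq: "(\<lambda>(a, x). a(i := x)) -` (Pi\<^sub>E I A) \<inter> space (PiM I (\<lambda>_. M) \<Otimes>\<^sub>M M)
      = (Pi\<^sub>E I ?A) \<times> A i"
      using I(2) sub by (fastforce simp: space_pair_measure space_PiM PiE_iff extensional_def split: if_splits)
    have "emeasure (distr (PiM I (\<lambda>_. M) \<Otimes>\<^sub>M M) (PiM I (\<lambda>_. M)) (\<lambda>(a, x). a(i := x))) (Pi\<^sub>E I A)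
      = emeasure (PiM I (\<lambda>_. M) \<Otimes>\<^sub>M M) ((Pi\<^sub>E I ?A) \<times> A i)"
      by (subst emeasure_distr) (use I(1) A in \<open>auto simp: eq intro!: sets_PiM_I_finite\<close>)
    also have "\<dots> = emeasure (PiM I (\<lambda>_. M)) (Pi\<^sub>E I ?A) * emeasure M (A i)"
      using I A by (intro M.emeasure_pair_measure_Times sets_PiM_I_finite) auto
    also have "emeasure (PiM I (\<lambda>_. M)) (Pi\<^sub>E I ?A) = (\<Prod>j\<in>I. emeasure M (?A j))"
      using I A by (intro P.emeasure_PiM) auto
    also have "\<dots> = (\<Prod>j\<in>I - {i}. emeasure M (A j))"
      using I by (simp add: prod.remove M.emeasure_space_1 cong: prod.cong_simp)
    finally show "emeasure (distr (PiM I (\<lambda>_. M) \<Otimes>\<^sub>M M) (PiM I (\<lambda>_. M)) (\<lambda>(a, x). a(i := x))) (Pi\<^sub>E I A)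
      = (\<Prod>j\<in>I. emeasure M (A j))"
      using I by (simp only: prod.remove[of I i] mult.commute)
  qed simp
qed

lemma measurable_PiM_overwrite:
  assumes "h ` S \<subseteq> L"
  shows "(\<lambda>(b, w). \<lambda>i\<in>I. if i \<in> S then w (h i) else b i)
    \<in> PiM I (\<lambda>_. M) \<Otimes>\<^sub>M PiM L (\<lambda>_. M) \<rightarrow>\<^sub>M PiM I (\<lambda>_. M)"
  unfolding split_beta'
proof (rule measurable_restrict)
  fix i assume "i \<in> I"
  then show "(\<lambda>x. if i \<in> S then snd x (h i) else fst x i)
      \<in> PiM I (\<lambda>_. M) \<Otimes>\<^sub>M PiM L (\<lambda>_. M) \<rightarrow>\<^sub>M M"
    using assms by (cases "i \<in> S") auto
qed

text \<open>Replacement of a whole block, with fresh values stored under other indices. Injectivity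
  of \<open>h\<close> keeps the overwritten coordinates independent; entries of \<open>w\<close>
  outside the image of \<open>h\<close> integrate out.\<close>

lemma distr_PiM_overwrite:
  assumes M: "prob_space M" and fin: "finite I" "finite L" and S: "S \<subseteq> I" "inj_on h S" "h ` S \<subseteq> L"
  shows "distr (PiM I (\<lambda>_. M) \<Otimes>\<^sub>M PiM L (\<lambda>_. M)) (PiM I (\<lambda>_. M))
      (\<lambda>(b, w). \<lambda>i\<in>I. if i \<in> S then w (h i) else b i) = PiM I (\<lambda>_. M)" (is "distr ?P _ ?T = _")
proof -
  interpret M: prob_space M by fact
  interpret P: product_sigma_finite "\<lambda>_. M" by standard
  interpret L: prob_space "PiM L (\<lambda>_. M)" by (rule prob_space_PiM, rule M)
  note [measurable] = measurable_PiM_overwrite[OF S(3)]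
  show ?thesis
  proof (rule P.PiM_eqI[OF fin(1)])
    fix A assume A: "\<And>j. j \<in> I \<Longrightarrow> A j \<in> sets M"
    \<comment> \<open>The constraints on \<open>S\<close> are carried along \<open>h\<close> to the
      fresh factor, and every released coordinate ranges over the whole space.\<close>
    let ?A = "\<lambda>j. if j \<in> S then space M else A j"
    let ?B = "\<lambda>l. if l \<in> h ` S then A (inv_into S h l) else space M"
    have sub: "A j \<subseteq> space M" if "j \<in> I" for j using A[OF that] by (rule sets.sets_into_space)
    have inv: "inv_into S h (h i) = i" if "i \<in> S" for i using S that by simp
    have eq: "?T -` (Pi\<^sub>E I A) \<inter> space ?P = Pi\<^sub>E I ?A \<times> Pi\<^sub>E L ?B"
    proof (intro subset_antisym subsetI)
      fix z assume z: "z \<in> ?T -` (Pi\<^sub>E I A) \<inter> space ?P"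
      obtain b w where [simp]: "z = (b, w)" by (cases z)
      have "?T (b, w) \<in> Pi\<^sub>E I A" "(b, w) \<in> space ?P" using z by auto
      then have *: "\<And>i. i \<in> I \<Longrightarrow> (if i \<in> S then w (h i) else b i) \<in> A i"
        "b \<in> Pi\<^sub>E I (\<lambda>_. space M)" "w \<in> Pi\<^sub>E L (\<lambda>_. space M)"
        by (auto simp: PiE_iff space_pair_measure space_PiM)
      have "b \<in> Pi\<^sub>E I ?A" using *(2) *(1)
        by (auto simp: PiE_iff) (metis *(1))
      moreover have "w (h i) \<in> A i" if "i \<in> S" for i using *(1)[of i] S(1) that by auto
      then have "w \<in> Pi\<^sub>E L ?B" using *(3) inv by (auto simp: PiE_iff)
      ultimately show "z \<in> Pi\<^sub>E I ?A \<times> Pi\<^sub>E L ?B" by simp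
    next
      fix z assume z: "z \<in> Pi\<^sub>E I ?A \<times> Pi\<^sub>E L ?B"
      obtain b w where [simp]: "z = (b, w)" by (cases z)
      have b: "b \<in> Pi\<^sub>E I ?A" and w: "w \<in> Pi\<^sub>E L ?B" using z by auto
      have "w (h i) \<in> A i" if "i \<in> S" for i
      proof -
        have "w (h i) \<in> ?B (h i)" using PiE_mem[OF w, of "h i"] that S(3) by blast
        then show ?thesis using that inv[OF that] by auto
      qed
      moreover have "b i \<in> A i" if "i \<in> I" "i \<notin> S" for i
        using PiE_mem[OF b that(1)] that(2) by simp
      ultimately have T: "?T (b, w) \<in> Pi\<^sub>E I A" by auto
      have "b i \<in> space M" if "i \<in> I" for i
        using PiE_mem[OF b that] sub[OF that] by (auto split: if_splits)
      moreover have "w l \<in> space M" if "l \<in> L" for l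
      proof (cases "l \<in> h ` S")
        case True
        have "inv_into S h l \<in> I" using S(1) inv_into_into[OF True] by blast
        from sub[OF this] show ?thesis using PiE_mem[OF w that] True by auto
      qed (use PiE_mem[OF w that] in simp)
      ultimately have "(b, w) \<in> space ?P"
        using b w by (auto simp: PiE_iff space_pair_measure space_PiM)
      with T show "z \<in> ?T -` (Pi\<^sub>E I A) \<inter> space ?P" by simp
    qed
    have B: "?B l \<in> sets M" for l
    proof (cases "l \<in> h ` S")
      case True
      then show ?thesis using A[of "inv_into S h l"] S(1) inv_into_into[OF True] by auto
    qed simp
    have "emeasure (distr ?P (PiM I (\<lambda>_. M)) ?T) (Pi\<^sub>E I A) = emeasure ?P (Pi\<^sub>E I ?A \<times> Pi\<^sub>E L ?B)"
      by (subst emeasure_distr) (use fin(1) A in \<open>auto simp: eq intro!: sets_PiM_I_finite\<close>)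
    also have "\<dots> = emeasure (PiM I (\<lambda>_. M)) (Pi\<^sub>E I ?A) * emeasure (PiM L (\<lambda>_. M)) (Pi\<^sub>E L ?B)"
      using fin A B by (intro L.emeasure_pair_measure_Times sets_PiM_I_finite) auto
    also have "emeasure (PiM I (\<lambda>_. M)) (Pi\<^sub>E I ?A) = (\<Prod>j\<in>I. emeasure M (?A j))"
      using fin A by (intro P.emeasure_PiM) auto
    also have "\<dots> = (\<Prod>j\<in>I - S. emeasure M (A j))"
      using fin by (intro prod.mono_neutral_cong_right) (auto simp: M.emeasure_space_1)
    also have "emeasure (PiM L (\<lambda>_. M)) (Pi\<^sub>E L ?B) = (\<Prod>l\<in>L. emeasure M (?B l))"
      using fin B by (intro P.emeasure_PiM) auto
    also have "\<dots> = (\<Prod>l\<in>h ` S. emeasure M (A (inv_into S h l)))"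
      using fin S(3) by (intro prod.mono_neutral_cong_right) (auto simp: M.emeasure_space_1)
    also have "\<dots> = (\<Prod>j\<in>S. emeasure M (A j))"
      using S(2) by (simp add: prod.reindex)
    also have "(\<Prod>j\<in>I - S. emeasure M (A j)) * \<dots> = (\<Prod>j\<in>I. emeasure M (A j))"
      using fin(1) S(1) by (metis prod.subset_diff)
    finally show "emeasure (distr ?P (PiM I (\<lambda>_. M)) ?T) (Pi\<^sub>E I A) = (\<Prod>j\<in>I. emeasure M (A j))" .
  qed simp
qed

text \<open>Points and noise are refreshed by separate maps, but the fresh data arrive as one pair,
  so the four factors are interleaved. On rectangles the integrand splits into a function of (a, c)
  and one of (b, e), and Tonelli separates them.\<close>

lemma distr_pair_pair:
  assumes ps: "prob_space A" "prob_space B" "prob_space C" "prob_space E"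
    and u[measurable]: "u \<in> A \<Otimes>\<^sub>M C \<rightarrow>\<^sub>M A" and v[measurable]: "v \<in> B \<Otimes>\<^sub>M E \<rightarrow>\<^sub>M B"
    and du: "distr (A \<Otimes>\<^sub>M C) A u = A" and dv: "distr (B \<Otimes>\<^sub>M E) B v = B"
  shows "distr ((A \<Otimes>\<^sub>M B) \<Otimes>\<^sub>M (C \<Otimes>\<^sub>M E)) (A \<Otimes>\<^sub>M B)
    (\<lambda>((a, b), (c, e)). (u (a, c), v (b, e))) = A \<Otimes>\<^sub>M B" (is "distr ?P _ ?T = _")
proof -
  interpret A: prob_space A by fact
  interpret B: prob_space B by fact
  interpret C: prob_space C by fact
  interpret E: prob_space E by fact
  interpret AB: pair_prob_space A B ..
  interpret CE: pair_prob_space C E ..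
  have T[measurable]: "?T \<in> ?P \<rightarrow>\<^sub>M A \<Otimes>\<^sub>M B"
    unfolding split_beta' by measurable
  have one: "(\<integral>\<^sup>+a. \<integral>\<^sup>+c. indicator X (u (a, c)) \<partial>C \<partial>A) = emeasure A X" if [measurable]: "X \<in> sets A" for X
  proof -
    have "(\<integral>\<^sup>+a. \<integral>\<^sup>+c. indicator X (u (a, c)) \<partial>C \<partial>A) = (\<integral>\<^sup>+z. indicator X (u z) \<partial>(A \<Otimes>\<^sub>M C))"
      by (rule C.nn_integral_fst) measurable
    also have "\<dots> = (\<integral>\<^sup>+z. indicator X z \<partial>(distr (A \<Otimes>\<^sub>M C) A u))"
      by (rule nn_integral_distr[symmetric]) measurable
    finally show ?thesis by (simp add: du)
  qed
  have two: "(\<integral>\<^sup>+b. \<integral>\<^sup>+e. indicator Y (v (b, e)) \<partial>E \<partial>B) = emeasure B Y" if [measurable]: "Y \<in> sets B" for Y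
  proof -
    have "(\<integral>\<^sup>+b. \<integral>\<^sup>+e. indicator Y (v (b, e)) \<partial>E \<partial>B) = (\<integral>\<^sup>+z. indicator Y (v z) \<partial>(B \<Otimes>\<^sub>M E))"
      by (rule E.nn_integral_fst) measurable
    also have "\<dots> = (\<integral>\<^sup>+z. indicator Y z \<partial>(distr (B \<Otimes>\<^sub>M E) B v))"
      by (rule nn_integral_distr[symmetric]) measurable
    finally show ?thesis by (simp add: dv)
  qed
  show ?thesis
  proof (rule sym, rule pair_measure_eqI)
    fix X Y assume [measurable]: "X \<in> sets A" "Y \<in> sets B"
    let ?u = "\<lambda>a c. indicator X (u (a, c)) :: ennreal"
    let ?v = "\<lambda>b e. indicator Y (v (b, e)) :: ennreal"
    have "emeasure (distr ?P (A \<Otimes>\<^sub>M B) ?T) (X \<times> Y)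
      = (\<integral>\<^sup>+z. indicator (X \<times> Y) z \<partial>distr ?P (A \<Otimes>\<^sub>M B) ?T)" by simp
    also have "\<dots> = (\<integral>\<^sup>+z. indicator (X \<times> Y) (?T z) \<partial>?P)"
      by (rule nn_integral_distr) measurable
    also have "\<dots> = (\<integral>\<^sup>+p. \<integral>\<^sup>+q. indicator (X \<times> Y) (?T (p, q)) \<partial>(C \<Otimes>\<^sub>M E) \<partial>(A \<Otimes>\<^sub>M B))"
      by (rule CE.nn_integral_fst[symmetric]) measurable
    also have "\<dots> = (\<integral>\<^sup>+a. \<integral>\<^sup>+b. \<integral>\<^sup>+q. indicator (X \<times> Y) (?T ((a, b), q)) \<partial>(C \<Otimes>\<^sub>M E) \<partial>B \<partial>A)"
      by (rule B.nn_integral_fst[symmetric]) measurable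
    also have "\<dots> = (\<integral>\<^sup>+a. \<integral>\<^sup>+b. \<integral>\<^sup>+c. \<integral>\<^sup>+e. ?u a c * ?v b e \<partial>E \<partial>C \<partial>B \<partial>A)"
    proof (intro nn_integral_cong)
      fix a b assume [measurable]: "a \<in> space A" "b \<in> space B"
      have "(\<integral>\<^sup>+q. indicator (X \<times> Y) (?T ((a, b), q)) \<partial>(C \<Otimes>\<^sub>M E))
        = (\<integral>\<^sup>+c. \<integral>\<^sup>+e. indicator (X \<times> Y) (?T ((a, b), (c, e))) \<partial>E \<partial>C)"
        by (rule E.nn_integral_fst[symmetric]) measurable
      then show "(\<integral>\<^sup>+q. indicator (X \<times> Y) (?T ((a, b), q)) \<partial>(C \<Otimes>\<^sub>M E))
        = (\<integral>\<^sup>+c. \<integral>\<^sup>+e. ?u a c * ?v b e \<partial>E \<partial>C)"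
        by (simp add: indicator_times)
    qed
    also have "\<dots> = (\<integral>\<^sup>+a. \<integral>\<^sup>+b. (\<integral>\<^sup>+c. ?u a c \<partial>C) * (\<integral>\<^sup>+e. ?v b e \<partial>E) \<partial>B \<partial>A)"
      by (intro nn_integral_cong) (simp add: nn_integral_cmult nn_integral_multc)
    also have "\<dots> = (\<integral>\<^sup>+a. \<integral>\<^sup>+c. ?u a c \<partial>C \<partial>A) * (\<integral>\<^sup>+b. \<integral>\<^sup>+e. ?v b e \<partial>E \<partial>B)"
      by (simp add: nn_integral_cmult nn_integral_multc)
    finally show "emeasure A X * emeasure B Y = emeasure (distr ?P (A \<Otimes>\<^sub>M B) ?T) (X \<times> Y)"
      by (simp add: one two)
  qed (simp_all add: A.sigma_finite_measure_axioms B.sigma_finite_measure_axioms)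
qed

section \<open>The law of the simulation, its marginals and its invariance\<close>

lemma finite_point_idx: "finite (point_idx N M n)"
  by (simp add: point_idx_def)

lemma finite_noise_idx: "finite (noise_idx N M n)"
  by (simp add: noise_idx_def)

lemma point_idx_mono: "n \<le> n' \<Longrightarrow> point_idx N M n' \<subseteq> point_idx N M n"
  by (auto simp: point_idx_def)

lemma noise_idx_mono: "n \<le> n' \<Longrightarrow> noise_idx N M n' \<subseteq> noise_idx N M n"
  by (auto simp: noise_idx_def)

lemma sim_from_sim_from:
  "n \<le> n' \<Longrightarrow> sim_from N M n' (sim_from N M n y) = sim_from N M n' y"
  using point_idx_mono[of n n' N M] noise_idx_mono[of n n' N M]
  by (simp add: sim_from_def Int_absorb1)

lemma sim_from_id:
  assumes "y \<in> space (sim_law N M \<mu> n)"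
  shows "sim_from N M n y = y"
  using assms
  by (cases y) (auto simp: sim_from_def sim_law_def space_pair_measure space_PiM PiE_def extensional_restrict)

lemma prob_space_sim_law:
  assumes "prob_space \<mu>"
  shows "prob_space (sim_law N M \<mu> n)"
  unfolding sim_law_def
  using assms prob_space_unif01 by (intro prob_space_pair prob_space_PiM) auto

lemma measurable_sim_from:
  assumes "n \<le> n'"
  shows "sim_from N M n' \<in> sim_law N M \<mu> n \<rightarrow>\<^sub>M sim_law N M \<mu> n'"
  unfolding sim_from_def[abs_def] sim_law_def
  by (rule measurable_Pair,
      rule measurable_compose[OF measurable_fst measurable_restrict_subset[OF point_idx_mono[OF assms]]],
      rule measurable_compose[OF measurable_snd measurable_restrict_subset[OF noise_idx_mono[OF assms]]])

lemma distr_sim_from: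
  assumes mu: "prob_space \<mu>" and "n \<le> n'"
  shows "distr (sim_law N M \<mu> n) (sim_law N M \<mu> n') (sim_from N M n') = sim_law N M \<mu> n'"
proof -
  interpret U: prob_space unif01 by (rule prob_space_unif01)
  interpret mu: prob_space \<mu> by fact
  interpret A: product_prob_space "\<lambda>_::nat \<times> nat. \<mu>" "point_idx N M n" by standard
  interpret B: product_prob_space "\<lambda>_::nat \<times> nat \<times> nat. unif01" "noise_idx N M n" by standard
  let ?A = "PiM (point_idx N M n) (\<lambda>_. \<mu>)" and ?A' = "PiM (point_idx N M n') (\<lambda>_. \<mu>)"
  let ?B = "PiM (noise_idx N M n) (\<lambda>_. unif01)" and ?B' = "PiM (noise_idx N M n') (\<lambda>_. unif01)"
  let ?p = "\<lambda>a. restrict a (point_idx N M n')" and ?q = "\<lambda>b. restrict b (noise_idx N M n')"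
  have p: "distr ?A ?A' ?p = ?A'"
    by (rule A.distr_restrict[OF point_idx_mono[OF assms(2)] finite_point_idx, symmetric])
  have q: "distr ?B ?B' ?q = ?B'"
    by (rule B.distr_restrict[OF noise_idx_mono[OF assms(2)] finite_noise_idx, symmetric])
  have "sigma_finite_measure (distr ?B ?B' ?q)"
    unfolding q by (rule prob_space_imp_sigma_finite, rule prob_space_PiM, rule prob_space_unif01)
  then have "distr ?A ?A' ?p \<Otimes>\<^sub>M distr ?B ?B' ?q = distr (?A \<Otimes>\<^sub>M ?B) (?A' \<Otimes>\<^sub>M ?B') (\<lambda>(a, b). (?p a, ?q b))"
    by (rule pair_measure_distr[OF measurable_restrict_subset[OF point_idx_mono[OF assms(2)]]
      measurable_restrict_subset[OF noise_idx_mono[OF assms(2)]]])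
  then show ?thesis
    unfolding p q sim_law_def sim_from_def[abs_def] split_beta' by (rule sym)
qed

text \<open>\<open>resample N M n m\<close> replaces the \<open>m\<close>-th training point of time \<open>n\<close> and the noise of its path
  by fresh copies. As this preserves the law, Fubini's theorem turns the conditional expectation
  given all other simulation variables into an integral over the copies.\<close>

definition resample ::
  "nat \<Rightarrow> nat \<Rightarrow> nat \<Rightarrow> nat \<Rightarrow> 'x sim \<times> 'x \<times> (nat \<Rightarrow> real) \<Rightarrow> 'x sim" where
  "resample N M n m = (\<lambda>((a, b), (x, w)). (a((n, m) := x),
     \<lambda>i\<in>noise_idx N M n. if i \<in> {n} \<times> {m} \<times> {n..<N} then w (snd (snd i)) else b i))"

abbreviation block_law :: "nat \<Rightarrow> 'x measure \<Rightarrow> ('x \<times> (nat \<Rightarrow> real)) measure" where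
  "block_law N \<mu> \<equiv> \<mu> \<Otimes>\<^sub>M PiM {..<N} (\<lambda>_. unif01)"

lemma resample_law:
  assumes mu: "prob_space \<mu>" and n: "n \<le> N" and m: "m \<in> {1..M}"
  shows "resample N M n m \<in> sim_law N M \<mu> n \<Otimes>\<^sub>M block_law N \<mu> \<rightarrow>\<^sub>M sim_law N M \<mu> n \<and>
    distr (sim_law N M \<mu> n \<Otimes>\<^sub>M block_law N \<mu>) (sim_law N M \<mu> n) (resample N M n m)
      = sim_law N M \<mu> n"
proof -
  let ?A = "PiM (point_idx N M n) (\<lambda>_. \<mu>)" and ?B = "PiM (noise_idx N M n) (\<lambda>_. unif01)"
  let ?E = "PiM {..<N} (\<lambda>_. unif01)"
  let ?u = "\<lambda>(a, x). a((n, m) := x)"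
  let ?v = "\<lambda>(b, w). \<lambda>i\<in>noise_idx N M n.
    if i \<in> {n} \<times> {m} \<times> {n..<N} then w (snd (snd i)) else b i"
  have i: "(n, m) \<in> point_idx N M n" using n m by (simp add: point_idx_def)
  have u: "?u \<in> ?A \<Otimes>\<^sub>M \<mu> \<rightarrow>\<^sub>M ?A"
    using measurable_add_dim[of "(n, m)" "point_idx N M n" "\<lambda>_. \<mu>"] i by (simp add: insert_absorb)
  \<comment> \<open>A fresh path carries noise indexed by time alone. Reading off the time is
    injective on the overwritten block because \<open>n\<close> and \<open>m\<close> are fixed
    there.\<close>
  have h: "(\<lambda>i. snd (snd i)) ` ({n} \<times> {m} \<times> {n..<N}) \<subseteq> {..<N}" by auto
  note v = measurable_PiM_overwrite[OF h, of "noise_idx N M n" unif01]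
  have du: "distr (?A \<Otimes>\<^sub>M \<mu>) ?A ?u = ?A"
    by (rule distr_PiM_update[OF mu finite_point_idx i])
  have "{n} \<times> {m} \<times> {n..<N} \<subseteq> noise_idx N M n" using m by (auto simp: noise_idx_def)
  moreover have "inj_on (\<lambda>i. snd (snd i)) ({n} \<times> {m} \<times> {n..<N})" by (auto simp: inj_on_def)
  ultimately have dv: "distr (?B \<Otimes>\<^sub>M ?E) ?B ?v = ?B"
    by (rule distr_PiM_overwrite[OF prob_space_unif01 finite_noise_idx finite_lessThan _ _ h])
  have T: "resample N M n m = (\<lambda>((a, b), (c, e)). (?u (a, c), ?v (b, e)))"
    by (simp add: resample_def fun_eq_iff)
  have T': "resample N M n m = (\<lambda>x. (?u (fst (fst x), fst (snd x)), ?v (snd (fst x), snd (snd x))))"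
    by (simp add: resample_def fun_eq_iff)
  have uv: "resample N M n m \<in> (?A \<Otimes>\<^sub>M ?B) \<Otimes>\<^sub>M (\<mu> \<Otimes>\<^sub>M ?E) \<rightarrow>\<^sub>M ?A \<Otimes>\<^sub>M ?B"
    unfolding T'
  proof (rule measurable_Pair)
    show "(\<lambda>x. ?u (fst (fst x), fst (snd x))) \<in> (?A \<Otimes>\<^sub>M ?B) \<Otimes>\<^sub>M (\<mu> \<Otimes>\<^sub>M ?E) \<rightarrow>\<^sub>M ?A"
      by (rule measurable_compose[OF _ u]) measurable
    show "(\<lambda>x. ?v (snd (fst x), snd (snd x))) \<in> (?A \<Otimes>\<^sub>M ?B) \<Otimes>\<^sub>M (\<mu> \<Otimes>\<^sub>M ?E) \<rightarrow>\<^sub>M ?B"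
      by (rule measurable_compose[OF _ v]) measurable
  qed
  have "distr ((?A \<Otimes>\<^sub>M ?B) \<Otimes>\<^sub>M (\<mu> \<Otimes>\<^sub>M ?E)) (?A \<Otimes>\<^sub>M ?B) (resample N M n m) = ?A \<Otimes>\<^sub>M ?B"
    unfolding T
    by (rule distr_pair_pair[OF prob_space_PiM prob_space_PiM mu prob_space_PiM u v du dv])
      (simp_all add: mu prob_space_unif01)
  with uv show ?thesis unfolding sim_law_def ..
qed

lemmas measurable_resample = resample_law[THEN conjunct1]
lemmas distr_resample = resample_law[THEN conjunct2]

lemma resample_point: "fst (resample N M n m (y, q)) (n, m) = fst q"
  by (cases y; cases q) (simp add: resample_def)

lemma resample_point_other:
  "m' \<noteq> m \<Longrightarrow> fst (resample N M n m (y, q)) (n, m') = fst y (n, m')"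
  by (cases y; cases q) (simp add: resample_def)

lemma resample_noise:
  "m \<in> {1..M} \<Longrightarrow> s \<in> {n..<N} \<Longrightarrow> snd (resample N M n m (y, q)) (n, m, s) = snd q s"
  by (cases y; cases q) (simp add: resample_def noise_idx_def)

lemma resample_noise_other:
  "m' \<noteq> m \<Longrightarrow> m' \<in> {1..M} \<Longrightarrow> s \<in> {n..<N} \<Longrightarrow>
    snd (resample N M n m (y, q)) (n, m', s) = snd y (n, m', s)"
  by (cases y; cases q) (simp add: resample_def noise_idx_def)

text \<open>Controls from time \<open>n\<close> on are computed from variables of times after
  \<open>n\<close>. Refreshing a path started at \<open>n\<close> thus leaves them alone, which is
  how the independence between the policy and the paths that evaluate it enters.\<close>

lemma sim_from_resample:
  assumes "n < k"
  shows "sim_from N M k (resample N M n m (y, q)) = sim_from N M k y"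
proof -
  have "noise_idx N M k \<subseteq> noise_idx N M n" using assms by (intro noise_idx_mono) simp
  moreover have "(n, m) \<notin> point_idx N M k" using assms by (simp add: point_idx_def)
  moreover have "i \<notin> {n} \<times> {m} \<times> {n..<N}" if "i \<in> noise_idx N M k" for i
    using that assms by (auto simp: noise_idx_def)
  ultimately show ?thesis
    by (cases y; cases q) (auto simp: sim_from_def resample_def fun_eq_iff restrict_def)
qed

section \<open>The controlled process\<close>

lemma traj_cong:
  assumes "\<And>s z. s \<in> {n..<n + j} \<Longrightarrow> pol s z = pol' s z" "\<And>s. s \<in> {n..<n + j} \<Longrightarrow> \<xi> s = \<xi>' s"
  shows "traj dyn pol \<xi> n x j = traj dyn pol' \<xi>' n x j"
  using assms by (induction j) (simp_all add: Let_def)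

lemma path_reward_cong:
  assumes "n \<le> N" "\<And>s z. s \<in> {n..<N} \<Longrightarrow> pol s z = pol' s z" "\<And>s. s \<in> {n..<N} \<Longrightarrow> \<xi> s = \<xi>' s"
  shows "path_reward N dyn f g pol \<xi> n x = path_reward N dyn f g pol' \<xi>' n x"
proof -
  have "traj dyn pol \<xi> n x (s - n) = traj dyn pol' \<xi>' n x (s - n)" if "s \<in> {n..N}" for s
    using assms that by (intro traj_cong) auto
  then show ?thesis
    using assms by (simp add: path_reward_def Let_def)
qed

lemma policy_value_cong:
  assumes "n \<le> N" "\<And>s z. s \<in> {n..<N} \<Longrightarrow> pol s z = pol' s z"
  shows "policy_value N dyn f g pol n x = policy_value N dyn f g pol' n x"
proof -
  have "path_reward N dyn f g pol \<xi> n x = path_reward N dyn f g pol' \<xi> n x" for \<xi>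
    using assms by (intro path_reward_cong) auto
  then show ?thesis by (simp add: policy_value_def)
qed

text \<open>\<open>traj\<close> unfolds at the last transition, whereas dynamic programming splits
  off the first.\<close>

lemma traj_Suc_shift:
  "traj dyn pol \<xi> n x (Suc j) = traj dyn pol \<xi> (Suc n) (dyn n x (\<xi> n) (pol n x)) j"
  by (induction j) (simp_all add: Let_def)

lemma path_reward_Suc:
  assumes "n < N"
  shows "path_reward N dyn f g pol \<xi> n x
    = f n x (pol n x) + path_reward N dyn f g pol \<xi> (Suc n) (dyn n x (\<xi> n) (pol n x))"
proof -
  have *: "traj dyn pol \<xi> n x (s - n) = traj dyn pol \<xi> (Suc n) (dyn n x (\<xi> n) (pol n x)) (s - Suc n)"
    if "s \<in> {Suc n..N}" for s
    using traj_Suc_shift[of dyn pol \<xi> n x "s - Suc n"] that by (simp add: Suc_diff_Suc del: traj.simps)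
  have "{n..<N} = insert n {Suc n..<N}" using assms by auto
  then show ?thesis
    using assms by (simp add: path_reward_def Let_def *)
qed

lemma space_unif01: "space unif01 = {0..1}"
  by (simp add: unif01_def space_restrict_space)

locale controlled_process =
  fixes D :: "'x::euclidean_space set" and U :: "'u::euclidean_space set"
    and N :: nat
    and \<mu> :: "'x measure"
    and dyn :: "nat \<Rightarrow> 'x \<Rightarrow> real \<Rightarrow> 'u \<Rightarrow> 'x"
    and r :: "nat \<Rightarrow> 'x \<Rightarrow> 'u \<Rightarrow> 'x \<Rightarrow> real"
    and f :: "nat \<Rightarrow> 'x \<Rightarrow> 'u \<Rightarrow> real" and g :: "'x \<Rightarrow> real"
    and Rbar :: real
  assumes mu: "prob_space \<mu>" "sets \<mu> = sets (restrict_space borel D)"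
    and dyn_meas: "\<And>n. n < N \<Longrightarrow>
          (\<lambda>(x, z, u). dyn n x z u) \<in> \<mu> \<Otimes>\<^sub>M unif01 \<Otimes>\<^sub>M restrict_space borel U \<rightarrow>\<^sub>M \<mu>"
    and r_meas: "\<And>n. n < N \<Longrightarrow>
          (\<lambda>(x, u, y). r n x u y) \<in> borel_measurable (\<mu> \<Otimes>\<^sub>M restrict_space borel U \<Otimes>\<^sub>M \<mu>)"
    and density: "\<And>n x u. n < N \<Longrightarrow> x \<in> D \<Longrightarrow> u \<in> U \<Longrightarrow>
          distributed unif01 \<mu> (\<lambda>z. dyn n x z u) (\<lambda>y. ennreal (r n x u y))"
    and Rbar: "Rbar > 0"
    and r_bound: "\<And>n x u y. n < N \<Longrightarrow> x \<in> D \<Longrightarrow> u \<in> U \<Longrightarrow> y \<in> D \<Longrightarrow>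
          0 \<le> r n x u y \<and> r n x u y \<le> Rbar\<^sup>2"
    and f_meas: "\<And>n. n < N \<Longrightarrow>
          (\<lambda>(x, u). f n x u) \<in> borel_measurable (\<mu> \<Otimes>\<^sub>M restrict_space borel U)"
    and f_bounded: "\<exists>B. \<forall>n<N. \<forall>x\<in>D. \<forall>u\<in>U. \<bar>f n x u\<bar> \<le> B"
    and g_meas: "g \<in> borel_measurable \<mu>"
    and g_bounded: "\<exists>B. \<forall>x\<in>D. \<bar>g x\<bar> \<le> B"
begin

section \<open>Measurability, boundedness and the one-step recursion\<close>

sublocale prob_space \<mu> by (rule mu(1))

abbreviation (input) control_space :: "'u measure" where
  "control_space \<equiv> restrict_space borel U"

abbreviation (input) noise_law :: "(nat \<Rightarrow> real) measure" where
  "noise_law \<equiv> PiM {..<N} (\<lambda>_. unif01)"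

lemma prob_space_noise_law: "prob_space noise_law"
  by (rule prob_space_PiM) (rule prob_space_unif01)

lemma space_mu: "space \<mu> = D"
  using sets_eq_imp_space_eq[OF mu(2)] by (simp add: space_restrict_space)

lemma dyn_in_D:
  assumes "n < N" "x \<in> D" "z \<in> {0..1}" "u \<in> U"
  shows "dyn n x z u \<in> D"
proof -
  have "(x, z, u) \<in> space (\<mu> \<Otimes>\<^sub>M unif01 \<Otimes>\<^sub>M control_space)"
    using assms by (simp add: space_pair_measure space_mu space_unif01 space_restrict_space)
  from measurable_space[OF dyn_meas[OF assms(1)] this] show ?thesis by (simp add: space_mu)
qed

text \<open>Initial state, noise and policy may all depend on the same parameter \<omega>. This
  covers simulated paths, whose policy is itself random, as well as the performance as a joint
  function of simulation and state.\<close>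

lemma measurable_traj:
  assumes x: "x \<in> Q \<rightarrow>\<^sub>M \<mu>"
    and \<xi>: "\<And>s. s \<in> {n..<N} \<Longrightarrow> (\<lambda>\<omega>. \<xi> \<omega> s) \<in> Q \<rightarrow>\<^sub>M unif01"
    and pol: "\<And>s. s \<in> {n..<N} \<Longrightarrow> (\<lambda>(\<omega>, z). pol \<omega> s z) \<in> Q \<Otimes>\<^sub>M \<mu> \<rightarrow>\<^sub>M control_space"
    and j: "n + j \<le> N"
  shows "(\<lambda>\<omega>. traj dyn (pol \<omega>) (\<xi> \<omega>) n (x \<omega>) j) \<in> Q \<rightarrow>\<^sub>M \<mu>"
  using j
proof (induction j)
  case 0
  then show ?case using x by simp
next
  case (Suc j)
  let ?z = "\<lambda>\<omega>. traj dyn (pol \<omega>) (\<xi> \<omega>) n (x \<omega>) j"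
  have z: "?z \<in> Q \<rightarrow>\<^sub>M \<mu>" using Suc by simp
  have s: "n + j \<in> {n..<N}" using Suc.prems by simp
  have u: "(\<lambda>\<omega>. pol \<omega> (n + j) (?z \<omega>)) \<in> Q \<rightarrow>\<^sub>M control_space"
    using measurable_compose[OF measurable_Pair[OF measurable_ident z] pol[OF s]] by simp
  show ?case
    using measurable_compose[OF measurable_Pair[OF z measurable_Pair[OF \<xi>[OF s] u]] dyn_meas[of "n + j"]] s
    by (simp add: Let_def)
qed

lemma measurable_path_reward:
  assumes x: "x \<in> Q \<rightarrow>\<^sub>M \<mu>"
    and \<xi>: "\<And>s. s \<in> {n..<N} \<Longrightarrow> (\<lambda>\<omega>. \<xi> \<omega> s) \<in> Q \<rightarrow>\<^sub>M unif01"
    and pol: "\<And>s. s \<in> {n..<N} \<Longrightarrow> (\<lambda>(\<omega>, z). pol \<omega> s z) \<in> Q \<Otimes>\<^sub>M \<mu> \<rightarrow>\<^sub>M control_space"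
    and n: "n \<le> N"
  shows "(\<lambda>\<omega>. path_reward N dyn f g (pol \<omega>) (\<xi> \<omega>) n (x \<omega>)) \<in> borel_measurable Q"
proof -
  let ?z = "\<lambda>s \<omega>. traj dyn (pol \<omega>) (\<xi> \<omega>) n (x \<omega>) (s - n)"
  have z: "?z s \<in> Q \<rightarrow>\<^sub>M \<mu>" if "s \<in> {n..N}" for s
    using that by (intro measurable_traj x \<xi> pol) auto
  have "(\<lambda>\<omega>. f s (?z s \<omega>) (pol \<omega> s (?z s \<omega>))) \<in> borel_measurable Q" if s: "s \<in> {n..<N}" for s
  proof -
    have zs: "?z s \<in> Q \<rightarrow>\<^sub>M \<mu>" using s by (intro z) auto
    have u: "(\<lambda>\<omega>. pol \<omega> s (?z s \<omega>)) \<in> Q \<rightarrow>\<^sub>M control_space"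
      using measurable_compose[OF measurable_Pair[OF measurable_ident zs] pol[OF s]] by simp
    show ?thesis
      using measurable_compose[OF measurable_Pair[OF zs u] f_meas[of s]] s by simp
  qed
  moreover have "(\<lambda>\<omega>. g (?z N \<omega>)) \<in> borel_measurable Q"
    using n by (intro measurable_compose[OF z g_meas]) auto
  ultimately show ?thesis
    by (auto simp: path_reward_def Let_def)
qed

lemma traj_in_D:
  assumes "x \<in> D" "\<And>s. s \<in> {n..<N} \<Longrightarrow> \<xi> s \<in> {0..1}"
    and "\<And>s z. s \<in> {n..<N} \<Longrightarrow> z \<in> D \<Longrightarrow> pol s z \<in> U" "n + j \<le> N"
  shows "traj dyn pol \<xi> n x j \<in> D"
  using assms(4)
proof (induction j)
  case (Suc j)
  then show ?case unfolding traj.simps Let_def by (intro dyn_in_D assms(2,3)) auto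
qed (use assms(1) in simp)

lemma path_reward_bounded:
  "\<exists>B. \<forall>n x pol \<xi>. n \<le> N \<longrightarrow> x \<in> D \<longrightarrow> (\<forall>s\<in>{n..<N}. \<xi> s \<in> {0..1}) \<longrightarrow>
    (\<forall>s\<in>{n..<N}. \<forall>z\<in>D. pol s z \<in> U) \<longrightarrow> \<bar>path_reward N dyn f g pol \<xi> n x\<bar> \<le> B"
proof -
  obtain B where B: "\<And>n x u. n < N \<Longrightarrow> x \<in> D \<Longrightarrow> u \<in> U \<Longrightarrow> \<bar>f n x u\<bar> \<le> B" using f_bounded by blast
  obtain C where C: "\<And>x. x \<in> D \<Longrightarrow> \<bar>g x\<bar> \<le> C" using g_bounded by blast
  have "\<bar>path_reward N dyn f g pol \<xi> n x\<bar> \<le> real N * \<bar>B\<bar> + C"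
    if h: "n \<le> N" "x \<in> D" "\<forall>s\<in>{n..<N}. \<xi> s \<in> {0..1}" "\<forall>s\<in>{n..<N}. \<forall>z\<in>D. pol s z \<in> U" for n x pol \<xi>
  proof -
    let ?z = "\<lambda>s. traj dyn pol \<xi> n x (s - n)"
    have z: "?z s \<in> D" if "s \<in> {n..N}" for s
      by (rule traj_in_D) (use h that in auto)
    have "\<bar>\<Sum>s\<in>{n..<N}. f s (?z s) (pol s (?z s))\<bar> \<le> (\<Sum>s\<in>{n..<N}. \<bar>B\<bar>)"
    proof (rule order_trans[OF sum_abs sum_mono])
      fix s assume s: "s \<in> {n..<N}"
      have "\<bar>f s (?z s) (pol s (?z s))\<bar> \<le> B"
        using s h z[of s] by (intro B) auto
      then show "\<bar>f s (?z s) (pol s (?z s))\<bar> \<le> \<bar>B\<bar>" by simp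
    qed
    also have "\<dots> \<le> real N * \<bar>B\<bar>" by (simp add: mult_right_mono)
    moreover have "\<bar>g (?z N)\<bar> \<le> C" using h z[of N] by (intro C) auto
    ultimately show ?thesis
      unfolding path_reward_def Let_def by (intro order_trans[OF abs_triangle_ineq]) linarith
  qed
  then show ?thesis by blast
qed

text \<open>A crude bound, uniform in time, state, policy and noise, for integrability and for the
  existence of suprema. The error estimate itself works with \<Gamma>.\<close>

definition reward_bound :: real where
  "reward_bound = (SOME B. \<forall>n x pol \<xi>. n \<le> N \<longrightarrow> x \<in> D \<longrightarrow> (\<forall>s\<in>{n..<N}. \<xi> s \<in> {0..1}) \<longrightarrow>
    (\<forall>s\<in>{n..<N}. \<forall>z\<in>D. pol s z \<in> U) \<longrightarrow> \<bar>path_reward N dyn f g pol \<xi> n x\<bar> \<le> B)"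

lemma path_reward_le:
  assumes "n \<le> N" "x \<in> D" "\<And>s. s \<in> {n..<N} \<Longrightarrow> \<xi> s \<in> {0..1}"
    and "\<And>s z. s \<in> {n..<N} \<Longrightarrow> z \<in> D \<Longrightarrow> pol s z \<in> U"
  shows "\<bar>path_reward N dyn f g pol \<xi> n x\<bar> \<le> reward_bound"
  using someI_ex[OF path_reward_bounded] assms unfolding reward_bound_def by blast

text \<open>A realisation of the later simulation variables determines controls only at later times,
  so admissibility is asked for from \<open>n\<close> on.\<close>

definition feedback_from :: "nat \<Rightarrow> (nat \<Rightarrow> 'x \<Rightarrow> 'u) \<Rightarrow> bool" where
  "feedback_from n pol \<longleftrightarrow> (\<forall>s\<in>{n..<N}. pol s \<in> \<mu> \<rightarrow>\<^sub>M control_space)"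

lemma feedback_from_measurable:
  "feedback_from n pol \<Longrightarrow> s \<in> {n..<N} \<Longrightarrow> pol s \<in> \<mu> \<rightarrow>\<^sub>M control_space"
  by (simp add: feedback_from_def)

lemma feedback_from_range:
  "feedback_from n pol \<Longrightarrow> s \<in> {n..<N} \<Longrightarrow> z \<in> D \<Longrightarrow> pol s z \<in> U"
  using measurable_space[OF feedback_from_measurable, of n pol s z]
  by (simp add: space_mu space_restrict_space)

lemma feedback_from_Suc: "feedback_from n pol \<Longrightarrow> feedback_from (Suc n) pol"
  by (auto simp: feedback_from_def)

lemma feedback_policies_iff: "pol \<in> feedback_policies N D U \<longleftrightarrow> feedback_from 0 pol"
  by (auto simp: feedback_policies_def feedback_from_def measurable_cong_sets[OF mu(2) refl])

lemma noise_law_range: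
  assumes "\<xi> \<in> space noise_law" "s \<in> {n..<N}"
  shows "\<xi> s \<in> {0..1}"
  using assms by (auto simp: space_PiM space_unif01 PiE_iff)

lemma path_reward_feedback_le:
  assumes "n \<le> N" "x \<in> D" "feedback_from n pol" "\<xi> \<in> space noise_law"
  shows "\<bar>path_reward N dyn f g pol \<xi> n x\<bar> \<le> reward_bound"
  using assms noise_law_range feedback_from_range by (intro path_reward_le)

lemma measurable_policy_value:
  assumes x: "x \<in> Q \<rightarrow>\<^sub>M \<mu>" and n: "n \<le> N"
    and pol: "\<And>s. s \<in> {n..<N} \<Longrightarrow> (\<lambda>(\<omega>, z). pol \<omega> s z) \<in> Q \<Otimes>\<^sub>M \<mu> \<rightarrow>\<^sub>M control_space"
  shows "(\<lambda>\<omega>. policy_value N dyn f g (pol \<omega>) n (x \<omega>)) \<in> borel_measurable Q"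
proof -
  interpret E: prob_space noise_law by (rule prob_space_noise_law)
  have "(\<lambda>p. path_reward N dyn f g (pol (fst p)) (snd p) n (x (fst p)))
      \<in> borel_measurable (Q \<Otimes>\<^sub>M noise_law)"
  proof (rule measurable_path_reward[OF _ _ _ n])
    show "(\<lambda>p. x (fst p)) \<in> Q \<Otimes>\<^sub>M noise_law \<rightarrow>\<^sub>M \<mu>"
      by (rule measurable_compose[OF measurable_fst x])
    fix s assume s: "s \<in> {n..<N}"
    then show "(\<lambda>p. snd p s) \<in> Q \<Otimes>\<^sub>M noise_law \<rightarrow>\<^sub>M unif01"
      by (intro measurable_compose[OF measurable_snd] measurable_component_singleton) auto
    have "(\<lambda>q. (fst (fst q), snd q)) \<in> (Q \<Otimes>\<^sub>M noise_law) \<Otimes>\<^sub>M \<mu> \<rightarrow>\<^sub>M Q \<Otimes>\<^sub>M \<mu>"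
      by measurable
    from measurable_compose[OF this pol[OF s]]
    show "(\<lambda>(p, z). pol (fst p) s z) \<in> (Q \<Otimes>\<^sub>M noise_law) \<Otimes>\<^sub>M \<mu> \<rightarrow>\<^sub>M control_space"
      by (simp add: split_beta')
  qed
  then show ?thesis
    unfolding policy_value_def
    by (intro E.borel_measurable_lebesgue_integral) (simp add: split_beta')
qed

lemma measurable_policy_value_fixed:
  assumes "n \<le> N" "feedback_from n pol"
  shows "policy_value N dyn f g pol n \<in> borel_measurable \<mu>"
proof -
  have "(\<lambda>x. policy_value N dyn f g pol n x) \<in> borel_measurable \<mu>"
  proof (rule measurable_policy_value[where x = "\<lambda>x. x", OF _ assms(1)])
    fix s assume "s \<in> {n..<N}"
    from measurable_compose[OF measurable_snd feedback_from_measurable[OF assms(2) this]]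
    show "(\<lambda>(\<omega>, z). pol s z) \<in> \<mu> \<Otimes>\<^sub>M \<mu> \<rightarrow>\<^sub>M control_space"
      by (simp add: split_beta')
  qed simp
  then show ?thesis .
qed

lemma measurable_path_reward_noise:
  assumes "n \<le> N" "feedback_from n pol"
  shows "(\<lambda>(x, \<xi>). path_reward N dyn f g pol \<xi> n x) \<in> borel_measurable (\<mu> \<Otimes>\<^sub>M noise_law)"
proof -
  have "(\<lambda>p. path_reward N dyn f g pol (snd p) n (fst p)) \<in> borel_measurable (\<mu> \<Otimes>\<^sub>M noise_law)"
  proof (rule measurable_path_reward[OF measurable_fst _ _ assms(1)])
    fix s assume s: "s \<in> {n..<N}"
    then show "(\<lambda>p. snd p s) \<in> \<mu> \<Otimes>\<^sub>M noise_law \<rightarrow>\<^sub>M unif01"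
      by (intro measurable_compose[OF measurable_snd] measurable_component_singleton) auto
    from measurable_compose[OF measurable_snd feedback_from_measurable[OF assms(2) s]]
    show "(\<lambda>(\<omega>, z). pol s z) \<in> (\<mu> \<Otimes>\<^sub>M noise_law) \<Otimes>\<^sub>M \<mu> \<rightarrow>\<^sub>M control_space"
      by (simp add: split_beta')
  qed
  then show ?thesis by (simp add: split_beta')
qed

lemma measurable_path_reward_fixed:
  assumes "n \<le> N" "x \<in> D" "feedback_from n pol"
  shows "(\<lambda>\<xi>. path_reward N dyn f g pol \<xi> n x) \<in> borel_measurable noise_law"
proof -
  have "(\<lambda>\<xi>. (x, \<xi>)) \<in> noise_law \<rightarrow>\<^sub>M \<mu> \<Otimes>\<^sub>M noise_law"
    using assms(2) by (intro measurable_Pair1') (simp add: space_mu)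
  from measurable_compose[OF this measurable_path_reward_noise[OF assms(1,3)]]
  show ?thesis by simp
qed

lemma policy_value_le:
  assumes "n \<le> N" "x \<in> D" "feedback_from n pol"
  shows "\<bar>policy_value N dyn f g pol n x\<bar> \<le> reward_bound"
proof -
  interpret E: prob_space noise_law by (rule prob_space_noise_law)
  have "\<bar>policy_value N dyn f g pol n x\<bar> \<le> (\<integral>\<xi>. \<bar>path_reward N dyn f g pol \<xi> n x\<bar> \<partial>noise_law)"
    unfolding policy_value_def by (rule integral_abs_bound)
  also have "\<dots> \<le> (\<integral>\<xi>. reward_bound \<partial>noise_law)"
  proof (rule integral_mono)
    show "integrable noise_law (\<lambda>\<xi>. \<bar>path_reward N dyn f g pol \<xi> n x\<bar>)"
      using measurable_path_reward_fixed[OF assms] path_reward_feedback_le[OF assms]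
      by (intro E.integrable_const_bound[where B = reward_bound] AE_I2) auto
  qed (use path_reward_feedback_le[OF assms] in auto)
  finally show ?thesis by (simp add: E.prob_space)
qed

text \<open>The noise at time \<open>n\<close> drives the first transition and is never read by the
  tail. It can therefore be refreshed independently of the tail, after which Fubini and the
  transition density turn its average into an integral against \<open>r\<close>.\<close>

lemma policy_value_Suc:
  assumes n: "n < N" and x: "x \<in> D" and pol: "feedback_from n pol"
  shows "policy_value N dyn f g pol n x = f n x (pol n x)
    + (\<integral>y. policy_value N dyn f g pol (Suc n) y * r n x (pol n x) y \<partial>\<mu>)"
proof -
  interpret E: prob_space noise_law by (rule prob_space_noise_law)
  interpret U: prob_space unif01 by (rule prob_space_unif01)
  interpret EU: pair_prob_space noise_law unif01 ..
  define u where "u = pol n x"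
  have u: "u \<in> U" unfolding u_def using feedback_from_range[OF pol _ x] n by simp
  have pol': "feedback_from (Suc n) pol" by (rule feedback_from_Suc[OF pol])
  let ?J = "\<lambda>\<xi> y. path_reward N dyn f g pol \<xi> (Suc n) y"
  have dm: "(\<lambda>z. dyn n x z u) \<in> unif01 \<rightarrow>\<^sub>M \<mu>"
    using distributed_measurable[OF density[OF n x u]] by simp
  have J: "(\<lambda>(y, \<xi>). ?J \<xi> y) \<in> borel_measurable (\<mu> \<Otimes>\<^sub>M noise_law)"
    using n by (intro measurable_path_reward_noise pol') simp
  have J1: "(\<lambda>\<xi>. ?J \<xi> (dyn n x (\<xi> n) u)) \<in> borel_measurable noise_law"
  proof -
    have "(\<lambda>\<xi>. \<xi> n) \<in> noise_law \<rightarrow>\<^sub>M unif01" using n by (intro measurable_component_singleton) simp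
    from measurable_compose[OF measurable_Pair[OF measurable_compose[OF this dm] measurable_ident] J]
    show ?thesis by simp
  qed
  have J2: "(\<lambda>(\<xi>, z). ?J \<xi> (dyn n x z u)) \<in> borel_measurable (noise_law \<Otimes>\<^sub>M unif01)"
    using measurable_compose[OF measurable_Pair[OF measurable_compose[OF measurable_snd dm] measurable_fst] J]
    by (simp add: split_beta')
  have le: "\<bar>?J \<xi> (dyn n x z u)\<bar> \<le> reward_bound" if "\<xi> \<in> space noise_law" "z \<in> {0..1}" for \<xi> z
    using n that u x by (intro path_reward_feedback_le pol' dyn_in_D) auto
  have int: "integrable (noise_law \<Otimes>\<^sub>M unif01) (\<lambda>(\<xi>, z). ?J \<xi> (dyn n x z u))"
    using J2 le by (intro EU.integrable_const_bound[where B = reward_bound] AE_I2)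
      (auto simp: space_pair_measure space_unif01)
  have int1: "integrable noise_law (\<lambda>\<xi>. ?J \<xi> (dyn n x (\<xi> n) u))"
    using J1 le noise_law_range[of _ n 0] n
    by (intro E.integrable_const_bound[where B = reward_bound] AE_I2) auto
  have upd: "(\<lambda>(\<xi>, z). \<xi>(n := z)) \<in> noise_law \<Otimes>\<^sub>M unif01 \<rightarrow>\<^sub>M noise_law"
    using measurable_add_dim[of n "{..<N}" "\<lambda>_. unif01"] n by (simp add: insert_absorb)
  have "policy_value N dyn f g pol n x = (\<integral>\<xi>. f n x u + ?J \<xi> (dyn n x (\<xi> n) u) \<partial>noise_law)"
    unfolding policy_value_def path_reward_Suc[OF n] u_def ..
  also have "\<dots> = f n x u + (\<integral>\<xi>. ?J \<xi> (dyn n x (\<xi> n) u) \<partial>noise_law)"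
    using int1 by (simp add: E.prob_space)
  also have "(\<integral>\<xi>. ?J \<xi> (dyn n x (\<xi> n) u) \<partial>noise_law)
    = (\<integral>p. (\<lambda>\<xi>. ?J \<xi> (dyn n x (\<xi> n) u)) ((\<lambda>(\<xi>, z). \<xi>(n := z)) p) \<partial>(noise_law \<Otimes>\<^sub>M unif01))"
    by (subst integral_distr[OF upd J1, symmetric])
      (use distr_PiM_update[OF prob_space_unif01, of "{..<N}" n] n in simp)
  also have "\<dots> = (\<integral>(\<xi>, z). ?J \<xi> (dyn n x z u) \<partial>(noise_law \<Otimes>\<^sub>M unif01))"
  proof (intro Bochner_Integration.integral_cong refl)
    fix p
    have "?J (\<xi>(n := z)) y = ?J \<xi> y" for \<xi> z y
      using n by (intro path_reward_cong) auto
    then show "(\<lambda>\<xi>. ?J \<xi> (dyn n x (\<xi> n) u)) ((\<lambda>(\<xi>, z). \<xi>(n := z)) p) = (case p of (\<xi>, z) \<Rightarrow> ?J \<xi> (dyn n x z u))"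
      by (simp add: split_beta)
  qed
  also have "\<dots> = (\<integral>z. policy_value N dyn f g pol (Suc n) (dyn n x z u) \<partial>unif01)"
    unfolding policy_value_def by (rule EU.integral_snd[OF int, symmetric])
  also have "\<dots> = (\<integral>y. r n x u y * policy_value N dyn f g pol (Suc n) y \<partial>\<mu>)"
    using n r_bound[OF n x u]
    by (intro distributed_integral[OF density[OF n x u], symmetric] measurable_policy_value_fixed pol')
      (auto simp: space_mu)
  finally show ?thesis by (simp add: u_def mult.commute)
qed

section \<open>The transition density on square-integrable functions; the value function\<close>

lemma measurable_r_fixed:
  assumes "n < N" "x \<in> D" "u \<in> U"
  shows "r n x u \<in> borel_measurable \<mu>"
proof -
  have "(\<lambda>y. (x, u, y)) \<in> \<mu> \<rightarrow>\<^sub>M \<mu> \<Otimes>\<^sub>M control_space \<Otimes>\<^sub>M \<mu>"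
    using assms by (intro measurable_Pair measurable_ident measurable_const)
      (auto simp: space_mu space_restrict_space)
  from measurable_compose[OF this r_meas[OF assms(1)]] show ?thesis by simp
qed

lemma integral_r:
  assumes "n < N" "x \<in> D" "u \<in> U"
  shows "(\<integral>y. r n x u y \<partial>\<mu>) = 1"
proof -
  interpret U: prob_space unif01 by (rule prob_space_unif01)
  show ?thesis
    using distributed_integral[OF density[OF assms], of "\<lambda>_. 1"] r_bound[OF assms]
    by (simp add: space_mu U.prob_space)
qed

lemma sqrt_r_L2:
  assumes "n < N" "x \<in> D" "u \<in> U"
  shows "(\<lambda>y. sqrt (r n x u y)) \<in> L2 \<mu>" "L2_norm \<mu> (\<lambda>y. sqrt (r n x u y)) = 1"
proof -
  have sq: "(sqrt (r n x u y))\<^sup>2 = r n x u y" if "y \<in> space \<mu>" for y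
    using r_bound[OF assms, of y] that by (simp add: space_mu)
  have "AE y in \<mu>. \<bar>sqrt (r n x u y)\<bar> \<le> Rbar"
    using r_bound[OF assms] Rbar by (intro AE_I2) (auto simp: space_mu intro: real_le_lsqrt)
  then show "(\<lambda>y. sqrt (r n x u y)) \<in> L2 \<mu>"
    using measurable_r_fixed[OF assms] by (intro L2_bounded) auto
  have "(\<integral>y. (sqrt (r n x u y))\<^sup>2 \<partial>\<mu>) = (\<integral>y. r n x u y \<partial>\<mu>)"
    by (rule Bochner_Integration.integral_cong) (simp_all add: sq)
  then show "L2_norm \<mu> (\<lambda>y. sqrt (r n x u y)) = 1"
    by (simp add: L2_norm_def integral_r[OF assms])
qed

lemma mult_r_integrable:
  assumes "n < N" "x \<in> D" "u \<in> U" "h \<in> L2 \<mu>"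
  shows "integrable \<mu> (\<lambda>y. h y * r n x u y)"
proof -
  have "AE y in \<mu>. \<bar>r n x u y\<bar> \<le> Rbar\<^sup>2"
    using r_bound[OF assms(1-3)] by (intro AE_I2) (auto simp: space_mu)
  then have "r n x u \<in> L2 \<mu>"
    using measurable_r_fixed[OF assms(1-3)] by (intro L2_bounded)
  then show ?thesis using assms(4) by (intro L2_integrable_mult)
qed

text \<open>Split \<open>r\<close> into two square roots: one has norm 1 because \<open>r\<close>
  integrates to 1, the other is at most \<open>Rbar\<close>. Bounding \<open>r\<close> itself would
  cost the factor \<open>Rbar\<^sup>2\<close>.\<close>

lemma integral_mult_r_le:
  assumes h: "n < N" "x \<in> D" "u \<in> U" and L: "h \<in> L2 \<mu>"
  shows "(\<integral>y. h y * r n x u y \<partial>\<mu>) \<le> Rbar * L2_norm \<mu> h"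
proof -
  let ?q = "\<lambda>y. sqrt (r n x u y)"
  have r: "0 \<le> r n x u y" "r n x u y \<le> Rbar\<^sup>2" if "y \<in> space \<mu>" for y
    using r_bound[OF h, of y] that by (auto simp: space_mu)
  have AE: "AE y in \<mu>. \<bar>h y * ?q y\<bar> \<le> \<bar>Rbar * h y\<bar>"
  proof (rule AE_I2)
    fix y assume "y \<in> space \<mu>"
    then have "\<bar>?q y\<bar> \<le> Rbar" using r[of y] Rbar by (auto intro: real_le_lsqrt)
    then show "\<bar>h y * ?q y\<bar> \<le> \<bar>Rbar * h y\<bar>"
      using Rbar mult_right_mono[of "\<bar>?q y\<bar>" Rbar "\<bar>h y\<bar>"] by (simp add: abs_mult mult.commute)
  qed
  have m: "(\<lambda>y. h y * ?q y) \<in> borel_measurable \<mu>"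
    using L measurable_r_fixed[OF h] by (auto simp: L2_def)
  note hq = L2_norm_mono[OF L2_scale[OF L] m AE]
  have "(\<integral>y. h y * r n x u y \<partial>\<mu>) = (\<integral>y. (h y * ?q y) * ?q y \<partial>\<mu>)"
    using r by (intro Bochner_Integration.integral_cong) (simp_all add: mult.assoc)
  also have "\<dots> \<le> L2_norm \<mu> (\<lambda>y. h y * ?q y) * L2_norm \<mu> ?q"
    by (rule L2_Cauchy_Schwarz[OF hq(1) sqrt_r_L2(1)[OF h]])
  also have "\<dots> \<le> Rbar * L2_norm \<mu> h"
    using hq(2) Rbar by (simp add: sqrt_r_L2(2)[OF h] L2_norm_scale)
  finally show ?thesis .
qed

text \<open>The constant 1 has norm 1 and average 1 under every transition, so the factor in the
  preceding bound cannot be smaller than 1. Hence the denominator 3 Rbar - 1 of the theorem is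
  positive.\<close>

lemma Rbar_ge_1:
  assumes "N > 0" "D \<noteq> {}" "U \<noteq> {}"
  shows "Rbar \<ge> 1"
proof -
  obtain x u where xu: "x \<in> D" "u \<in> U" using assms by blast
  have 1: "(\<lambda>_. 1) \<in> L2 \<mu>" by (simp add: L2_def)
  show ?thesis
    using integral_mult_r_le[OF assms(1) xu 1] by (simp add: integral_r[OF assms(1) xu] L2_norm_def prob_space)
qed

text \<open>Controls before \<open>n\<close> do not affect the value from \<open>n\<close> on, and
  any constant control can fill them in. This brings the policy into the class over which the
  supremum is taken.\<close>

lemma feedback_from_extend:
  assumes "U \<noteq> {}" "feedback_from n pol"
  shows "\<exists>pol'\<in>feedback_policies N D U. \<forall>s\<in>{n..<N}. pol' s = pol s"
proof -
  obtain u where "u \<in> U" using assms by blast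
  then have "(\<lambda>_. u) \<in> \<mu> \<rightarrow>\<^sub>M control_space"
    by (intro measurable_const) (simp add: space_restrict_space)
  then have "feedback_from 0 (\<lambda>s. if n \<le> s then pol s else (\<lambda>_. u))"
    using assms(2) by (auto simp: feedback_from_def)
  then show ?thesis unfolding feedback_policies_iff[symmetric] by (rule bexI[rotated]) auto
qed

lemma policy_value_le_value_fun:
  assumes "U \<noteq> {}" "n \<le> N" "x \<in> D" "feedback_from n pol"
  shows "policy_value N dyn f g pol n x \<le> value_fun N D U dyn f g n x"
proof -
  obtain pol' where pol': "pol' \<in> feedback_policies N D U" "\<And>s. s \<in> {n..<N} \<Longrightarrow> pol' s = pol s"
    using feedback_from_extend[OF assms(1,4)] by blast
  have "policy_value N dyn f g pol n x = policy_value N dyn f g pol' n x"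
    using assms(2) pol'(2) by (intro policy_value_cong) auto
  also have "\<dots> \<le> value_fun N D U dyn f g n x"
    unfolding value_fun_def
  proof (rule cSUP_upper[OF pol'(1)])
    have "policy_value N dyn f g p n x \<le> reward_bound" if "p \<in> feedback_policies N D U" for p
    proof -
      have "feedback_from n p" using that by (auto simp: feedback_policies_iff feedback_from_def)
      from policy_value_le[OF assms(2,3) this] show ?thesis by simp
    qed
    then show "bdd_above ((\<lambda>p. policy_value N dyn f g p n x) ` feedback_policies N D U)"
      by (rule bdd_aboveI2)
  qed
  finally show ?thesis .
qed

lemma value_fun_least:
  assumes "U \<noteq> {}" "\<And>pol. feedback_from n pol \<Longrightarrow> policy_value N dyn f g pol n x \<le> c"
  shows "value_fun N D U dyn f g n x \<le> c"
  unfolding value_fun_def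
proof (rule cSUP_least)
  \<comment> \<open>No decision remains at time \<open>N\<close>, so any function can be extended to
    an admissible policy.\<close>
  have "feedback_from N (\<lambda>_ _. undefined)" by (simp add: feedback_from_def)
  then show "feedback_policies N D U \<noteq> {}" using feedback_from_extend[OF assms(1)] by blast
  fix pol assume "pol \<in> feedback_policies N D U"
  then show "policy_value N dyn f g pol n x \<le> c"
    by (intro assms(2)) (auto simp: feedback_policies_iff feedback_from_def)
qed

lemma value_fun_terminal:
  assumes "U \<noteq> {}" "x \<in> D"
  shows "value_fun N D U dyn f g N x = g x"
proof -
  interpret E: prob_space noise_law by (rule prob_space_noise_law)
  have v: "policy_value N dyn f g pol N x = g x" for pol
    by (simp add: policy_value_def path_reward_def E.prob_space)
  show ?thesis
    using value_fun_least[OF assms(1), of N x "g x"]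
      policy_value_le_value_fun[OF assms(1) order_refl assms(2), of "\<lambda>_ _. undefined"]
    by (auto simp: v feedback_from_def)
qed

lemma value_fun_bounded:
  assumes "U \<noteq> {}" "n \<le> N" "x \<in> D"
  shows "\<bar>value_fun N D U dyn f g n x\<bar> \<le> reward_bound"
proof -
  have "feedback_from N (\<lambda>_ _. undefined)" by (simp add: feedback_from_def)
  from feedback_from_extend[OF assms(1) this] obtain pol where "feedback_from 0 pol"
    by (auto simp: feedback_policies_iff)
  then have "feedback_from n pol" by (auto simp: feedback_from_def)
  then have "- reward_bound \<le> value_fun N D U dyn f g n x"
    using policy_value_le_value_fun[OF assms] policy_value_le[OF assms(2,3)] by force
  moreover have "value_fun N D U dyn f g n x \<le> reward_bound"
    using policy_value_le[OF assms(2,3)] by (intro value_fun_least[OF assms(1)]) force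
  ultimately show ?thesis by simp
qed

end

section \<open>Performance iteration\<close>

locale regress_later = controlled_process D U N \<mu> dyn r f g Rbar + L2_basis \<mu> \<phi>
  for D :: "'x::euclidean_space set" and U :: "'u::euclidean_space set"
    and N :: nat and \<mu> :: "'x measure" and dyn r f g Rbar
    and \<phi> :: "'k::finite \<Rightarrow> 'x \<Rightarrow> real" +
  fixes M :: nat and uhat :: "nat \<Rightarrow> 'x sim \<Rightarrow> 'x \<Rightarrow> 'u" and \<Gamma> :: real
  assumes N: "N \<ge> 1" and M: "M \<ge> 1"
    and V_meas: "\<And>n. n \<le> N \<Longrightarrow> value_fun N D U dyn f g n \<in> borel_measurable \<mu>"
    and policy: "performance_iteration N M \<mu> U dyn r f g \<phi> uhat"
    and Gamma_sim: "\<And>n m. n \<in> {1..N} \<Longrightarrow> m \<in> {1..M} \<Longrightarrow>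
          AE y in sim_law N M \<mu> n. \<bar>sim_reward N M dyn f g uhat n m y\<bar> \<le> \<Gamma>"
    and Gamma_nonneg: "0 \<le> \<Gamma>"
begin

section \<open>The estimated policy and its exact performance\<close>

abbreviation "sim \<equiv> sim_law N M \<mu>"
abbreviation "V \<equiv> value_fun N D U dyn f g"
abbreviation "Vt \<equiv> est_policy_value N M \<mu> r f g uhat"
abbreviation "J \<equiv> sim_reward N M dyn f g uhat"

text \<open>\<open>uhat s\<close> expects exactly the variables of times after \<open>s\<close>.
  Restricting inside lets a single realisation drive a whole path.\<close>

definition sim_policy :: "'x sim \<Rightarrow> nat \<Rightarrow> 'x \<Rightarrow> 'u" where
  "sim_policy y s = uhat s (sim_from N M (Suc s) y)"

text \<open>\<open>W n y\<close> agrees with the estimated performance at time \<open>n\<close>, but it accepts a realisation \<open>y\<close>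
  that also contains the simulation variables of times up to \<open>n\<close>.\<close>

definition W :: "nat \<Rightarrow> 'x sim \<Rightarrow> 'x \<Rightarrow> real" where
  "W n y = policy_value N dyn f g (sim_policy y) n"

lemma prob_space_sim: "prob_space (sim n)"
  by (rule prob_space_sim_law[OF mu(1)])

lemma uhat_measurable:
  "n < N \<Longrightarrow> (\<lambda>(y, x). uhat n y x) \<in> sim (Suc n) \<Otimes>\<^sub>M \<mu> \<rightarrow>\<^sub>M control_space"
  using policy unfolding performance_iteration_def by blast

lemma measurable_sim_policy:
  assumes "s < N" "k \<le> Suc s"
  shows "(\<lambda>(y, z). sim_policy y s z) \<in> sim k \<Otimes>\<^sub>M \<mu> \<rightarrow>\<^sub>M control_space"
  using measurable_compose[OF measurable_Pair[OF
      measurable_compose[OF measurable_fst measurable_sim_from[OF assms(2)]] measurable_snd]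
      uhat_measurable[OF assms(1)]]
  by (simp add: sim_policy_def split_beta')

lemma feedback_sim_policy:
  assumes "y \<in> space (sim k)" "k \<le> Suc n"
  shows "feedback_from n (sim_policy y)"
  unfolding feedback_from_def
proof
  fix s assume "s \<in> {n..<N}"
  then have s: "s < N" "k \<le> Suc s" using assms(2) by auto
  from measurable_compose[OF measurable_Pair1'[OF assms(1)] measurable_sim_policy[OF s]]
  show "sim_policy y s \<in> \<mu> \<rightarrow>\<^sub>M control_space" by simp
qed

lemma sim_policy_sim_from: "k \<le> Suc s \<Longrightarrow> sim_policy (sim_from N M k y) s = sim_policy y s"
  by (simp add: sim_policy_def sim_from_sim_from)

lemma W_sim_from:
  assumes "n \<le> N" "k \<le> Suc n"
  shows "W n (sim_from N M k y) = W n y"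
proof
  fix x
  show "W n (sim_from N M k y) x = W n y x"
    unfolding W_def using assms by (intro policy_value_cong) (auto simp: sim_policy_sim_from)
qed

text \<open>The estimated control takes its values in \<open>U\<close> and is defined on a nonempty
  space.\<close>

lemma U_nonempty: "U \<noteq> {}"
proof -
  interpret S: prob_space "sim (Suc 0)" by (rule prob_space_sim)
  obtain y x where "y \<in> space (sim (Suc 0))" "x \<in> space \<mu>"
    using S.not_empty not_empty by blast
  then have "(y, x) \<in> space (sim (Suc 0) \<Otimes>\<^sub>M \<mu>)" by (simp add: space_pair_measure)
  then show ?thesis
    using measurable_space[OF uhat_measurable[of 0]] N by (fastforce simp: space_restrict_space)
qed

text \<open>Backward induction: the recursion that defines the performance is the one-step identity
  for policy values. The path form is the one that simulated rewards average to and that the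
  supremum \<open>V\<close> dominates.\<close>

lemma Vt_eq_W:
  assumes "n \<le> N" "y \<in> space (sim (Suc n))" "x \<in> D"
  shows "Vt n y x = W n y x"
  using assms
proof (induction n arbitrary: y x rule: inc_induct)
  case base
  interpret E: prob_space noise_law by (rule prob_space_noise_law)
  show ?case
    by (simp add: est_policy_value.simps W_def policy_value_def path_reward_def E.prob_space)
next
  case (step n)
  have pol: "sim_policy y n x = uhat n y x"
    using step.prems by (simp add: sim_policy_def sim_from_id)
  have y': "sim_from N M (Suc (Suc n)) y \<in> space (sim (Suc (Suc n)))"
    using measurable_space[OF measurable_sim_from step.prems(1)] by simp
  have "Vt n y x = f n x (uhat n y x)
      + (\<integral>x'. Vt (Suc n) (sim_from N M (Suc (Suc n)) y) x' * r n x (uhat n y x) x' \<partial>\<mu>)"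
    using step.hyps by (subst est_policy_value.simps) simp
  also have "(\<integral>x'. Vt (Suc n) (sim_from N M (Suc (Suc n)) y) x' * r n x (uhat n y x) x' \<partial>\<mu>)
      = (\<integral>x'. W (Suc n) y x' * r n x (uhat n y x) x' \<partial>\<mu>)"
    using step.IH[OF y'] step.hyps
    by (intro Bochner_Integration.integral_cong) (simp_all add: space_mu W_sim_from)
  also have "f n x (uhat n y x) + \<dots> = W n y x"
    using policy_value_Suc[OF step.hyps(2) step.prems(2) feedback_sim_policy[OF step.prems(1) order_refl]]
    by (simp add: W_def pol)
  finally show ?case .
qed

lemma measurable_W:
  assumes "n \<le> N" "k \<le> Suc n"
  shows "(\<lambda>(y, x). W n y x) \<in> borel_measurable (sim k \<Otimes>\<^sub>M \<mu>)"
proof -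
  have "(\<lambda>p. policy_value N dyn f g (sim_policy (fst p)) n (snd p)) \<in> borel_measurable (sim k \<Otimes>\<^sub>M \<mu>)"
  proof (rule measurable_policy_value[OF measurable_snd assms(1)])
    fix s assume s: "s \<in> {n..<N}"
    have "(\<lambda>q. (fst (fst q), snd q)) \<in> (sim k \<Otimes>\<^sub>M \<mu>) \<Otimes>\<^sub>M \<mu> \<rightarrow>\<^sub>M sim k \<Otimes>\<^sub>M \<mu>" by measurable
    from measurable_compose[OF this measurable_sim_policy[of s k]] s assms
    show "(\<lambda>(p, z). sim_policy (fst p) s z) \<in> (sim k \<Otimes>\<^sub>M \<mu>) \<Otimes>\<^sub>M \<mu> \<rightarrow>\<^sub>M control_space"
      by (simp add: split_beta')
  qed
  then show ?thesis by (simp add: W_def split_beta')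
qed

lemma W_bounded:
  assumes "n \<le> N" "k \<le> Suc n" "y \<in> space (sim k)" "x \<in> D"
  shows "\<bar>W n y x\<bar> \<le> reward_bound"
  unfolding W_def using assms by (intro policy_value_le feedback_sim_policy)

lemma W_L2:
  assumes "n \<le> N" "k \<le> Suc n" "y \<in> space (sim k)"
  shows "W n y \<in> L2 \<mu>"
proof (rule L2_bounded)
  show "W n y \<in> borel_measurable \<mu>"
    unfolding W_def using assms by (intro measurable_policy_value_fixed feedback_sim_policy)
  show "AE x in \<mu>. \<bar>W n y x\<bar> \<le> reward_bound"
    using W_bounded[OF assms] by (intro AE_I2) (simp add: space_mu)
qed

lemma V_L2:
  assumes "n \<le> N"
  shows "V n \<in> L2 \<mu>"
  using V_meas[OF assms] value_fun_bounded[OF U_nonempty assms]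
  by (intro L2_bounded AE_I2) (simp_all add: space_mu)

lemma W_minus_V_L2:
  assumes "n \<le> N" "k \<le> Suc n"
  shows "(\<lambda>(y, x). W n y x - V n x) \<in> L2 (sim k \<Otimes>\<^sub>M \<mu>)"
proof -
  interpret P: prob_space "sim k" by (rule prob_space_sim)
  interpret PM: pair_prob_space "sim k" \<mu> ..
  have "(\<lambda>p. V n (snd p)) \<in> borel_measurable (sim k \<Otimes>\<^sub>M \<mu>)"
    by (rule measurable_compose[OF measurable_snd V_meas[OF assms(1)]])
  then have m: "(\<lambda>(y, x). W n y x - V n x) \<in> borel_measurable (sim k \<Otimes>\<^sub>M \<mu>)"
    using measurable_W[OF assms] by (simp add: split_beta')
  have "\<bar>W n y x - V n x\<bar> \<le> 2 * reward_bound" if "y \<in> space (sim k)" "x \<in> D" for y x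
    using W_bounded[OF assms that] value_fun_bounded[OF U_nonempty assms(1) that(2)] by linarith
  then show ?thesis
    using m by (intro PM.L2_bounded[where B = "2 * reward_bound"] AE_I2)
      (auto simp: space_pair_measure space_mu)
qed

section \<open>Simulated rewards and their conditional means\<close>

lemma J_eq: "J n m y = path_reward N dyn f g (sim_policy y) (\<lambda>s. snd y (n, m, s)) n (fst y (n, m))"
  by (simp add: sim_reward_def sim_policy_def[abs_def])

lemma measurable_point:
  assumes "n \<le> N" "m \<in> {1..M}"
  shows "(\<lambda>y. fst y (n, m)) \<in> sim n \<rightarrow>\<^sub>M \<mu>"
  unfolding sim_law_def
  using assms by (intro measurable_compose[OF measurable_fst] measurable_component_singleton)
    (simp add: point_idx_def)

lemma distr_point:
  assumes "n \<le> N" "m \<in> {1..M}"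
  shows "distr (sim n) \<mu> (\<lambda>y. fst y (n, m)) = \<mu>"
proof -
  interpret A: product_prob_space "\<lambda>_::nat \<times> nat. \<mu>" "point_idx N M n" by standard
  interpret B: prob_space "PiM (noise_idx N M n) (\<lambda>_. unif01)"
    by (rule prob_space_PiM) (rule prob_space_unif01)
  have i: "(n, m) \<in> point_idx N M n" using assms by (simp add: point_idx_def)
  have c: "(\<lambda>a. a (n, m)) \<in> PiM (point_idx N M n) (\<lambda>_. \<mu>) \<rightarrow>\<^sub>M \<mu>"
    using i by (rule measurable_component_singleton)
  have "distr (sim n) \<mu> (\<lambda>y. fst y (n, m))
    = distr (distr (sim n) (PiM (point_idx N M n) (\<lambda>_. \<mu>)) fst) \<mu> (\<lambda>a. a (n, m))"
    unfolding sim_law_def by (subst distr_distr[OF c measurable_fst]) (simp add: o_def)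
  also have "\<dots> = \<mu>"
    unfolding sim_law_def B.distr_pair_fst by (rule A.PiM_component[OF i])
  finally show ?thesis .
qed

lemma measurable_J:
  assumes n: "n \<le> N" and m: "m \<in> {1..M}"
  shows "J n m \<in> borel_measurable (sim n)"
proof -
  have "(\<lambda>y. path_reward N dyn f g (sim_policy y) (\<lambda>s. snd y (n, m, s)) n (fst y (n, m)))
    \<in> borel_measurable (sim n)"
  proof (rule measurable_path_reward[OF measurable_point[OF assms] _ _ n])
    fix s assume s: "s \<in> {n..<N}"
    then show "(\<lambda>y. snd y (n, m, s)) \<in> sim n \<rightarrow>\<^sub>M unif01"
      unfolding sim_law_def using m
      by (intro measurable_compose[OF measurable_snd] measurable_component_singleton)
        (simp add: noise_idx_def)
    show "(\<lambda>(y, z). sim_policy y s z) \<in> sim n \<Otimes>\<^sub>M \<mu> \<rightarrow>\<^sub>M control_space"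
      using s by (intro measurable_sim_policy) auto
  qed
  then show ?thesis by (simp add: J_eq[abs_def])
qed

lemma J_bounded:
  assumes n: "n \<le> N" and m: "m \<in> {1..M}" and y: "y \<in> space (sim n)"
  shows "\<bar>J n m y\<bar> \<le> reward_bound"
  unfolding J_eq
proof (rule path_reward_le[OF n])
  show "fst y (n, m) \<in> D" using measurable_space[OF measurable_point[OF n m] y] by (simp add: space_mu)
  have "feedback_from n (sim_policy y)" by (rule feedback_sim_policy[OF y]) simp
  then show "sim_policy y s z \<in> U" if "s \<in> {n..<N}" "z \<in> D" for s z
    using that by (rule feedback_from_range)
  fix s assume "s \<in> {n..<N}"
  then have "(n, m, s) \<in> noise_idx N M n" using m by (simp add: noise_idx_def)
  then show "snd y (n, m, s) \<in> {0..1}"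
    using y unfolding sim_law_def
    by (auto simp: space_pair_measure space_PiM space_unif01 PiE_iff)
qed

definition summand :: "nat \<Rightarrow> nat \<Rightarrow> 'k \<Rightarrow> 'x sim \<Rightarrow> real" where
  "summand n m k y = J n m y * \<phi> k (fst y (n, m))"

text \<open>The conditional mean of \<open>summand n m k\<close> given everything but the
  \<open>m\<close>-th path of time \<open>n\<close>. It is the same for all \<open>m\<close>, and
  over k it forms the right-hand side of the normal equations for the projection of
  \<open>W n y\<close>.\<close>

definition cond_mean :: "nat \<Rightarrow> 'k \<Rightarrow> 'x sim \<Rightarrow> real" where
  "cond_mean n k y = (\<integral>x. W n y x * \<phi> k x \<partial>\<mu>)"

lemma basis_point_L2:
  assumes "n \<le> N" "m \<in> {1..M}"
  shows "(\<lambda>y. \<phi> k (fst y (n, m))) \<in> L2 (sim n)"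
    and "L2_norm (sim n) (\<lambda>y. \<phi> k (fst y (n, m))) = L2_norm \<mu> (\<phi> k)"
  using L2_distr[OF measurable_point[OF assms] distr_point[OF assms] L] by auto

lemma measurable_summand:
  assumes "n \<le> N" "m \<in> {1..M}"
  shows "summand n m k \<in> borel_measurable (sim n)"
  using measurable_J[OF assms] L2_measurable[OF basis_point_L2(1)[OF assms]]
  by (simp add: summand_def[abs_def])

lemma summand_L2:
  assumes "n \<le> N" "m \<in> {1..M}"
  shows "summand n m k \<in> L2 (sim n)"
proof -
  have "AE y in sim n. \<bar>summand n m k y\<bar> \<le> \<bar>reward_bound * \<phi> k (fst y (n, m))\<bar>"
    using J_bounded[OF assms]
    by (intro AE_I2) (force simp: summand_def abs_mult intro!: mult_right_mono)
  from L2_norm_mono(1)[OF L2_scale[OF basis_point_L2(1)[OF assms]] measurable_summand[OF assms] this]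
  show ?thesis .
qed

lemma summand_norm_le:
  assumes "n \<in> {1..N}" "m \<in> {1..M}"
  shows "L2_norm (sim n) (summand n m k) \<le> \<Gamma> * L2_norm \<mu> (\<phi> k)"
proof -
  have n: "n \<le> N" using assms by simp
  have "AE y in sim n. \<bar>summand n m k y\<bar> \<le> \<bar>\<Gamma> * \<phi> k (fst y (n, m))\<bar>"
    using Gamma_sim[OF assms]
    by eventually_elim (simp add: summand_def abs_mult mult_right_mono abs_of_nonneg[OF Gamma_nonneg])
  from L2_norm_mono(2)[OF L2_scale[OF basis_point_L2(1)[OF n assms(2)]] measurable_summand[OF n assms(2)] this]
  show ?thesis
    using Gamma_nonneg by (simp add: L2_norm_scale basis_point_L2(2)[OF n assms(2)])
qed

lemma cond_mean_L2:
  assumes n: "n \<le> N" "k' \<le> Suc n"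
  shows "cond_mean n k \<in> L2 (sim k')"
proof -
  interpret P: prob_space "sim k'" by (rule prob_space_sim)
  show ?thesis
  proof (rule P.L2_bounded)
    have "(\<lambda>p. \<phi> k (snd p)) \<in> borel_measurable (sim k' \<Otimes>\<^sub>M \<mu>)"
      by (rule measurable_compose[OF measurable_snd L2_measurable[OF L]])
    then have "(\<lambda>(y, x). W n y x * \<phi> k x) \<in> borel_measurable (sim k' \<Otimes>\<^sub>M \<mu>)"
      using measurable_W[OF assms] by (simp add: split_beta')
    then show "cond_mean n k \<in> borel_measurable (sim k')"
      unfolding cond_mean_def[abs_def] by (rule borel_measurable_lebesgue_integral)
    show "AE y in sim k'. \<bar>cond_mean n k y\<bar> \<le> (\<integral>x. reward_bound * \<bar>\<phi> k x\<bar> \<partial>\<mu>)"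
    proof (rule AE_I2)
      fix y assume y: "y \<in> space (sim k')"
      have "\<bar>cond_mean n k y\<bar> \<le> (\<integral>x. \<bar>W n y x * \<phi> k x\<bar> \<partial>\<mu>)"
        unfolding cond_mean_def by (rule integral_abs_bound)
      also have "\<dots> \<le> (\<integral>x. reward_bound * \<bar>\<phi> k x\<bar> \<partial>\<mu>)"
      proof (rule integral_mono)
        show "integrable \<mu> (\<lambda>x. \<bar>W n y x * \<phi> k x\<bar>)"
          using L2_integrable_mult[OF W_L2[OF assms y] L] by (rule integrable_abs)
        show "integrable \<mu> (\<lambda>x. reward_bound * \<bar>\<phi> k x\<bar>)"
          using L2_integrable[OF L] by (intro integrable_mult_right integrable_abs)
        fix x assume "x \<in> space \<mu>"
        then show "\<bar>W n y x * \<phi> k x\<bar> \<le> reward_bound * \<bar>\<phi> k x\<bar>"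
          using W_bounded[OF assms y] by (simp add: space_mu abs_mult mult_right_mono)
      qed
      finally show "\<bar>cond_mean n k y\<bar> \<le> (\<integral>x. reward_bound * \<bar>\<phi> k x\<bar> \<partial>\<mu>)" .
    qed
  qed
qed

lemma sim_policy_resample:
  "n \<le> s \<Longrightarrow> sim_policy (resample N M n m (y, q)) s = sim_policy y s"
  by (simp add: sim_policy_def sim_from_resample)

text \<open>After refreshing, the old realisation \<open>y\<close> survives only through the
  policy.\<close>

lemma summand_resample:
  assumes "n \<le> N" "m \<in> {1..M}"
  shows "summand n m k (resample N M n m (y, q))
    = path_reward N dyn f g (sim_policy y) (snd q) n (fst q) * \<phi> k (fst q)"
proof -
  have "J n m (resample N M n m (y, q)) = path_reward N dyn f g (sim_policy y) (snd q) n (fst q)"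
    unfolding J_eq resample_point
    by (rule path_reward_cong[OF assms(1)]) (simp_all add: sim_policy_resample resample_noise assms(2)[simplified])
  then show ?thesis by (simp add: summand_def resample_point)
qed

lemma summand_resample_other:
  assumes "n \<le> N" "m' \<in> {1..M}" "m' \<noteq> m"
  shows "summand n m' k (resample N M n m (y, q)) = summand n m' k y"
proof -
  have "J n m' (resample N M n m (y, q)) = J n m' y"
    unfolding J_eq resample_point_other[OF assms(3)]
    by (rule path_reward_cong[OF assms(1)])
      (simp_all add: sim_policy_resample resample_noise_other[OF assms(3,2)])
  then show ?thesis by (simp add: summand_def resample_point_other[OF assms(3)])
qed

lemma cond_mean_resample:
  assumes "n \<le> N"
  shows "cond_mean n k (resample N M n m (y, q)) = cond_mean n k y"
proof -
  have "W n (resample N M n m (y, q)) x = W n y x" for x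
    unfolding W_def by (rule policy_value_cong[OF assms]) (simp add: sim_policy_resample)
  then show ?thesis by (simp add: cond_mean_def)
qed

lemma integral_block:
  assumes n: "n \<le> N" and y: "y \<in> space (sim n)"
  shows "(\<integral>q. path_reward N dyn f g (sim_policy y) (snd q) n (fst q) * \<phi> k (fst q) \<partial>block_law N \<mu>)
    = cond_mean n k y"
proof -
  interpret E: prob_space noise_law by (rule prob_space_noise_law)
  interpret B: pair_prob_space \<mu> noise_law ..
  have fb: "feedback_from n (sim_policy y)" by (rule feedback_sim_policy[OF y]) simp
  let ?p = "\<lambda>q. path_reward N dyn f g (sim_policy y) (snd q) n (fst q)"
  have m: "?p \<in> borel_measurable (block_law N \<mu>)"
    using measurable_path_reward_noise[OF n fb] by (simp add: split_beta')
  have ph: "(\<lambda>q. \<phi> k (fst q)) \<in> L2 (block_law N \<mu>)"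
    by (rule L2_distr(1)[OF measurable_fst E.distr_pair_fst L])
  have "?p \<in> L2 (block_law N \<mu>)"
    using m path_reward_feedback_le[OF n _ fb]
    by (intro B.L2_bounded[where B = reward_bound] AE_I2) (auto simp: space_pair_measure space_mu)
  from L2_integrable_mult[OF this ph]
  have "(\<integral>q. ?p q * \<phi> k (fst q) \<partial>block_law N \<mu>)
    = (\<integral>x. \<integral>\<xi>. path_reward N dyn f g (sim_policy y) \<xi> n x * \<phi> k x \<partial>noise_law \<partial>\<mu>)"
    by (subst B.integral_fst'[symmetric]) simp_all
  then show ?thesis
    by (simp add: cond_mean_def W_def policy_value_def)
qed

text \<open>A test function \<open>H\<close> that ignores the refreshed block acts as a function of
  the remaining variables, so this is the defining property of a conditional expectation. Refreshing
  preserves the law, and integrating out the fresh block with \<open>y\<close> fixed leaves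
  \<open>cond_mean\<close>.\<close>

lemma integral_summand_mult:
  assumes n: "n \<le> N" and m: "m \<in> {1..M}" and H: "H \<in> L2 (sim n)"
    and inv: "\<And>y q. H (resample N M n m (y, q)) = H y"
  shows "(\<integral>y. summand n m k y * H y \<partial>sim n) = (\<integral>y. cond_mean n k y * H y \<partial>sim n)"
proof -
  interpret P: prob_space "sim n" by (rule prob_space_sim)
  interpret E: prob_space noise_law by (rule prob_space_noise_law)
  interpret B: pair_prob_space \<mu> noise_law ..
  interpret PB: pair_prob_space "sim n" "block_law N \<mu>" ..
  let ?T = "resample N M n m"
  let ?F = "\<lambda>y. summand n m k y * H y"
  note T = measurable_resample[OF mu(1) n m] and dT = distr_resample[OF mu(1) n m]
  have i: "integrable (sim n) ?F" by (rule L2_integrable_mult[OF summand_L2[OF n m] H])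
  have Fm: "?F \<in> borel_measurable (sim n)" using i by (rule borel_measurable_integrable)
  have iT: "integrable (sim n \<Otimes>\<^sub>M block_law N \<mu>) (\<lambda>p. ?F (?T p))"
    using i integrable_distr_eq[OF T Fm] by (simp only: dT)
  have "(\<integral>y. ?F y \<partial>sim n) = (\<integral>p. ?F (?T p) \<partial>(sim n \<Otimes>\<^sub>M block_law N \<mu>))"
    using integral_distr[OF T Fm] by (simp only: dT)
  also have "\<dots> = (\<integral>y. \<integral>q. ?F (?T (y, q)) \<partial>block_law N \<mu> \<partial>sim n)"
    by (rule PB.integral_fst'[OF iT, symmetric])
  also have "\<dots> = (\<integral>y. cond_mean n k y * H y \<partial>sim n)"
  proof (rule Bochner_Integration.integral_cong[OF refl])
    fix y assume y: "y \<in> space (sim n)"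
    show "(\<integral>q. ?F (?T (y, q)) \<partial>block_law N \<mu>) = cond_mean n k y * H y"
      unfolding inv summand_resample[OF n m] by (simp add: integral_block[OF n y])
  qed
  finally show ?thesis .
qed

section \<open>Monte Carlo error of the regression coefficients\<close>

definition noise :: "nat \<Rightarrow> nat \<Rightarrow> 'k \<Rightarrow> 'x sim \<Rightarrow> real" where
  "noise n m k y = summand n m k y - cond_mean n k y"

lemma noise_L2:
  assumes "n \<le> N" "m \<in> {1..M}"
  shows "noise n m k \<in> L2 (sim n)"
  unfolding noise_def[abs_def]
  by (rule L2_diff[OF summand_L2[OF assms] cond_mean_L2[OF assms(1)]]) simp

lemma integral_noise_mult:
  assumes n: "n \<le> N" and m: "m \<in> {1..M}" and H: "H \<in> L2 (sim n)"
    and inv: "\<And>y q. H (resample N M n m (y, q)) = H y"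
  shows "(\<integral>y. noise n m k y * H y \<partial>sim n) = 0"
proof -
  have "cond_mean n k \<in> L2 (sim n)" by (rule cond_mean_L2[OF n]) simp
  from L2_integrable_mult[OF this H] L2_integrable_mult[OF summand_L2[OF n m] H]
  show ?thesis
    by (simp add: noise_def left_diff_distrib integral_summand_mult[OF assms])
qed

text \<open>Refreshing path \<open>m\<close> changes neither path \<open>m'\<close> nor the
  conditional mean, so the noise of \<open>m'\<close> is a legitimate test function for
  \<open>m\<close>. No independence of the two paths is claimed: they share the policy.\<close>

lemma noise_orthogonal:
  assumes "n \<le> N" "m \<in> {1..M}" "m' \<in> {1..M}" "m \<noteq> m'"
  shows "(\<integral>y. noise n m k y * noise n m' k y \<partial>sim n) = 0"
  using assms
  by (intro integral_noise_mult noise_L2)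
    (simp_all add: noise_def summand_resample_other cond_mean_resample)

text \<open>The noise is orthogonal to the conditional mean, so by Pythagoras its second moment is
  at most that of the summand.\<close>

lemma noise_variance_le:
  assumes "n \<in> {1..N}" "m \<in> {1..M}"
  shows "(\<integral>y. noise n m k y * noise n m k y \<partial>sim n) \<le> (\<Gamma> * L2_norm \<mu> (\<phi> k))\<^sup>2"
proof -
  have n: "n \<le> N" using assms by simp
  let ?s = "summand n m k" and ?c = "cond_mean n k" and ?Z = "noise n m k"
  have c: "?c \<in> L2 (sim n)" by (rule cond_mean_L2[OF n]) simp
  note s = summand_L2[OF n assms(2)] and Z = noise_L2[OF n assms(2)]
  have 0: "(\<integral>y. ?Z y * ?c y \<partial>sim n) = 0"
    by (rule integral_noise_mult[OF n assms(2) c]) (rule cond_mean_resample[OF n])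
  have "(\<integral>y. (?s y)\<^sup>2 \<partial>sim n) = (\<integral>y. ?Z y * ?Z y + 2 * (?Z y * ?c y) + (?c y)\<^sup>2 \<partial>sim n)"
    by (intro Bochner_Integration.integral_cong) (simp_all add: noise_def power2_eq_square algebra_simps)
  also have "\<dots> = (\<integral>y. ?Z y * ?Z y \<partial>sim n) + (\<integral>y. (?c y)\<^sup>2 \<partial>sim n)"
    using L2_integrable_mult[OF Z Z] L2_integrable_mult[OF Z c] L2_integrable_square[OF c]
    by (simp add: 0)
  finally have "(\<integral>y. ?Z y * ?Z y \<partial>sim n) \<le> (L2_norm (sim n) ?s)\<^sup>2"
    by (simp add: L2_norm_square)
  also have "\<dots> \<le> (\<Gamma> * L2_norm \<mu> (\<phi> k))\<^sup>2"
    by (rule power_mono[OF summand_norm_le[OF assms] L2_norm_nonneg])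
  finally show ?thesis .
qed

definition coeff_noise :: "nat \<Rightarrow> 'x sim \<Rightarrow> real ^ 'k" where
  "coeff_noise n y = (\<chi> k. (1 / real M) * (\<Sum>m = 1..M. noise n m k y))"

lemma coeff_noise_component_L2:
  assumes "n \<le> N"
  shows "(\<lambda>y. coeff_noise n y $ k) \<in> L2 (sim n)"
  unfolding coeff_noise_def vec_lambda_beta
  by (intro L2_scale L2_sum noise_L2 assms)

text \<open>Orthogonality removes the mixed terms from the square of the average; M diagonal terms
  divided by M^2 give the rate 1 / M.\<close>

lemma coeff_noise_component_le:
  assumes n: "n \<in> {1..N}"
  shows "(\<integral>y. (coeff_noise n y $ k)\<^sup>2 \<partial>sim n) \<le> (\<Gamma> * L2_norm \<mu> (\<phi> k))\<^sup>2 / real M"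
proof -
  have n': "n \<le> N" using n by simp
  let ?G = "(\<Gamma> * L2_norm \<mu> (\<phi> k))\<^sup>2"
  have "(\<integral>y. (coeff_noise n y $ k)\<^sup>2 \<partial>sim n)
    = (\<integral>y. (1 / real M)\<^sup>2 * (\<Sum>m = 1..M. \<Sum>m' = 1..M. noise n m k y * noise n m' k y) \<partial>sim n)"
    unfolding coeff_noise_def vec_lambda_beta power_mult_distrib
    by (simp add: power2_eq_square sum_product)
  also have "\<dots> = (1 / real M)\<^sup>2
      * (\<Sum>m = 1..M. \<Sum>m' = 1..M. (\<integral>y. noise n m k y * noise n m' k y \<partial>sim n))"
    using L2_integrable_mult[OF noise_L2[OF n'] noise_L2[OF n']]
    by (subst integral_mult_right_zero, subst Bochner_Integration.integral_sum)
      (auto intro!: Bochner_Integration.integrable_sum simp: Bochner_Integration.integral_sum)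
  finally have eq: "(\<integral>y. (coeff_noise n y $ k)\<^sup>2 \<partial>sim n) = (1 / real M)\<^sup>2
      * (\<Sum>m = 1..M. \<Sum>m' = 1..M. (\<integral>y. noise n m k y * noise n m' k y \<partial>sim n))" .
  have "(\<Sum>m = 1..M. \<Sum>m' = 1..M. (\<integral>y. noise n m k y * noise n m' k y \<partial>sim n))
      \<le> (\<Sum>m = 1..M. \<Sum>m' = 1..M. if m' = m then ?G else 0)"
    using noise_variance_le[OF n] noise_orthogonal[OF n'] by (intro sum_mono) auto
  also have "\<dots> = (\<Sum>m = 1..M. ?G)" by (intro sum.cong refl) (simp add: sum.delta)
  finally have "(\<integral>y. (coeff_noise n y $ k)\<^sup>2 \<partial>sim n) \<le> (1 / real M)\<^sup>2 * (real M * ?G)"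
    unfolding eq by (intro mult_left_mono) simp_all
  then show ?thesis using M by (simp add: power2_eq_square)
qed

text \<open>Bounding every component by the largest basis norm costs the factor sqrt K.\<close>

lemma coeff_noise_L2:
  assumes n: "n \<in> {1..N}"
  shows "(\<lambda>y. norm (coeff_noise n y)) \<in> L2 (sim n)"
    and "L2_norm (sim n) (\<lambda>y. norm (coeff_noise n y))
      \<le> sqrt (real CARD('k)) / sqrt (real M) * \<Gamma> * (MAX k. L2_norm \<mu> (\<phi> k))"
proof -
  have n': "n \<le> N" using n by simp
  let ?X = "MAX k. L2_norm \<mu> (\<phi> k)"
  have sq: "(norm (coeff_noise n y))\<^sup>2 = (\<Sum>k\<in>UNIV. (coeff_noise n y $ k)\<^sup>2)" for y
    by (simp add: norm_vec_def L2_set_def sum_nonneg)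
  have i: "integrable (sim n) (\<lambda>y. (coeff_noise n y $ k)\<^sup>2)" for k
    by (rule L2_integrable_square[OF coeff_noise_component_L2[OF n']])
  have "(\<lambda>y. norm (coeff_noise n y)) \<in> borel_measurable (sim n)"
    unfolding norm_vec_def L2_set_def
    using L2_measurable[OF coeff_noise_component_L2[OF n']] by auto
  then show "(\<lambda>y. norm (coeff_noise n y)) \<in> L2 (sim n)"
    using i by (simp add: L2_def sq)
  have X: "0 \<le> ?X" by (rule order_trans[OF L2_norm_nonneg Max_ge]) auto
  have "(L2_norm (sim n) (\<lambda>y. norm (coeff_noise n y)))\<^sup>2
      = (\<Sum>k\<in>UNIV. \<integral>y. (coeff_noise n y $ k)\<^sup>2 \<partial>sim n)"
    using i by (simp add: L2_norm_square sq)
  also have "\<dots> \<le> (\<Sum>k\<in>(UNIV :: 'k set). (\<Gamma> * ?X)\<^sup>2 / real M)"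
  proof (rule sum_mono)
    fix k :: 'k
    have "(\<Gamma> * L2_norm \<mu> (\<phi> k))\<^sup>2 \<le> (\<Gamma> * ?X)\<^sup>2"
      using Gamma_nonneg by (intro power_mono mult_left_mono Max_ge) (auto simp: L2_norm_nonneg)
    then show "(\<integral>y. (coeff_noise n y $ k)\<^sup>2 \<partial>sim n) \<le> (\<Gamma> * ?X)\<^sup>2 / real M"
      using order_trans[OF coeff_noise_component_le[OF n] divide_right_mono] by simp
  qed
  also have "\<dots> = (sqrt (real CARD('k)) / sqrt (real M) * \<Gamma> * ?X)\<^sup>2"
    by (simp add: power_mult_distrib power_divide)
  finally show "L2_norm (sim n) (\<lambda>y. norm (coeff_noise n y))
      \<le> sqrt (real CARD('k)) / sqrt (real M) * \<Gamma> * ?X"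
    using Gamma_nonneg X by (rule_tac power2_le_imp_le) simp_all
qed

section \<open>Regression estimate and greedy control\<close>

abbreviation "coeff_hat \<equiv> coeff_est N M \<mu> dyn f g \<phi> uhat"

lemma coeff_eq:
  "coeff_hat n y = matrix_inv (gram \<mu> \<phi>) *v (coeff_noise n y + (\<chi> k. cond_mean n k y))"
proof -
  have "(1 / real M) *\<^sub>R (\<Sum>m = 1..M. J n m y *\<^sub>R (\<chi> k. \<phi> k (fst y (n, m))))
    = coeff_noise n y + (\<chi> k. cond_mean n k y)"
    using M by (simp add: vec_eq_iff coeff_noise_def noise_def summand_def sum_subtractf field_simps)
  then show ?thesis by (simp add: coeff_est_def)
qed

text \<open>The conditional mean part of the coefficients solves the normal equations for the
  projection of \<open>W\<close> and cancels exactly. Only the Monte Carlo part is left.\<close>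

lemma regression_error:
  assumes "n \<le> N" "y \<in> space (sim n)"
  shows "L2_norm \<mu> (\<lambda>x. lincomb \<phi> (coeff_hat n y) x - L2_proj \<mu> \<phi> (W n y) x)
    \<le> matrix_op_norm (inv_sqrt_matrix (gram \<mu> \<phi>)) * norm (coeff_noise n y)"
proof -
  have W: "W n y \<in> L2 \<mu>" by (rule W_L2[OF assms(1) _ assms(2)]) simp
  have "lincomb \<phi> (coeff_hat n y) x - L2_proj \<mu> \<phi> (W n y) x
    = lincomb \<phi> (matrix_inv (gram \<mu> \<phi>) *v coeff_noise n y) x" for x
    unfolding L2_proj_eq[OF W] lincomb_diff[symmetric] coeff_eq matrix_vector_mult_diff_distrib[symmetric]
    by (simp add: cond_mean_def)
  then show ?thesis using lincomb_inv_gram_norm_le[of "coeff_noise n y"] by simp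
qed

text \<open>This is the gain of regressing later: the expectation of a combination of basis
  functions is known exactly for every control, so the quantity maximised by the policy is a true
  integral against \<open>r\<close>.\<close>

lemma sum_basis_cond:
  assumes "n < N" "x \<in> D" "u \<in> U"
  shows "(\<Sum>k\<in>UNIV. a $ k * basis_cond \<mu> r \<phi> n k x u) = (\<integral>y. lincomb \<phi> a y * r n x u y \<partial>\<mu>)"
proof -
  have "(\<integral>y. lincomb \<phi> a y * r n x u y \<partial>\<mu>) = (\<integral>y. (\<Sum>k\<in>UNIV. a $ k * (\<phi> k y * r n x u y)) \<partial>\<mu>)"
    by (intro Bochner_Integration.integral_cong) (simp_all add: lincomb_def sum_distrib_right mult.assoc)
  then show ?thesis
    using mult_r_integrable[OF assms L] by (simp add: basis_cond_def)
qed

lemma uhat_maximal: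
  assumes n: "n < N" and y: "y \<in> space (sim (Suc n))" and x: "x \<in> D"
  shows "uhat n y x \<in> U"
    and "u \<in> U \<Longrightarrow> f n x u + (\<integral>z. lincomb \<phi> (coeff_hat (Suc n) y) z * r n x u z \<partial>\<mu>)
      \<le> f n x (uhat n y x) + (\<integral>z. lincomb \<phi> (coeff_hat (Suc n) y) z * r n x (uhat n y x) z \<partial>\<mu>)"
proof -
  have *: "is_arg_max (\<lambda>u. f n x u + (\<Sum>k\<in>UNIV. coeff_hat (Suc n) y $ k * basis_cond \<mu> r \<phi> n k x u))
      (\<lambda>u. u \<in> U) (uhat n y x)"
    using policy n y x unfolding performance_iteration_def space_mu by blast
  show u': "uhat n y x \<in> U" using * by (simp add: is_arg_max_def)
  assume u: "u \<in> U"
  show "f n x u + (\<integral>z. lincomb \<phi> (coeff_hat (Suc n) y) z * r n x u z \<partial>\<mu>)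
      \<le> f n x (uhat n y x) + (\<integral>z. lincomb \<phi> (coeff_hat (Suc n) y) z * r n x (uhat n y x) z \<partial>\<mu>)"
    using * u unfolding is_arg_max_def sum_basis_cond[OF n x u, symmetric] sum_basis_cond[OF n x u', symmetric]
    by (meson not_less)
qed

lemma W_le_V:
  assumes "n \<le> N" "k \<le> Suc n" "y \<in> space (sim k)" "x \<in> D"
  shows "W n y x \<le> V n x"
  unfolding W_def
  using assms by (intro policy_value_le_value_fun U_nonempty feedback_sim_policy)

lemma one_step_error:
  assumes n: "n < N" and y: "y \<in> space (sim (Suc n))" and x: "x \<in> D"
  defines "h \<equiv> lincomb \<phi> (coeff_hat (Suc n) y)"
  shows "\<bar>W n y x - V n x\<bar>
    \<le> Rbar * (L2_norm \<mu> (\<lambda>z. V (Suc n) z - h z) + L2_norm \<mu> (\<lambda>z. h z - W (Suc n) y z))"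
proof -
  let ?j = "Suc n"
  let ?u = "uhat n y x"
  let ?a = "L2_norm \<mu> (\<lambda>z. V ?j z - h z)"
  have j: "?j \<le> N" using n by simp
  have hL: "h \<in> L2 \<mu>" unfolding h_def by (rule lincomb_L2)
  have VL: "V ?j \<in> L2 \<mu>" by (rule V_L2[OF j])
  have WL: "W ?j y \<in> L2 \<mu>" by (rule W_L2[OF j _ y]) simp
  note int = mult_r_integrable[OF n x]
  have u: "?u \<in> U" by (rule uhat_maximal(1)[OF n y x])
  have "sim_policy y n x = ?u" using y by (simp add: sim_policy_def sim_from_id)
  then have W: "W n y x = f n x ?u + (\<integral>z. W ?j y z * r n x ?u z \<partial>\<mu>)"
    using policy_value_Suc[OF n x feedback_sim_policy[OF y order_refl]] by (simp add: W_def)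
  \<comment> \<open>The supremum is bounded one competitor at a time. The later value of the
    competitor is at most \<open>V ?j\<close>, and replacing that by \<open>h\<close> costs
    \<open>Rbar * ?a\<close> whatever its control is; the control can then be exchanged for the
    greedy one.\<close>
  have V: "V n x \<le> f n x ?u + (\<integral>z. h z * r n x ?u z \<partial>\<mu>) + Rbar * ?a"
  proof (rule value_fun_least[OF U_nonempty])
    fix pol assume pol: "feedback_from n pol"
    let ?v = "pol n x"
    have v: "?v \<in> U" using feedback_from_range[OF pol _ x] n by simp
    note pol' = feedback_from_Suc[OF pol]
    have PL: "policy_value N dyn f g pol ?j \<in> L2 \<mu>"
      using measurable_policy_value_fixed[OF j pol'] policy_value_le[OF j _ pol']
      by (intro L2_bounded AE_I2) (auto simp: space_mu)
    have "(\<integral>z. policy_value N dyn f g pol ?j z * r n x ?v z \<partial>\<mu>) \<le> (\<integral>z. V ?j z * r n x ?v z \<partial>\<mu>)"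
      using policy_value_le_value_fun[OF U_nonempty j _ pol'] r_bound[OF n x v]
      by (intro integral_mono int PL VL v mult_right_mono) (auto simp: space_mu)
    also have "\<dots> = (\<integral>z. h z * r n x ?v z + (V ?j z - h z) * r n x ?v z \<partial>\<mu>)"
      by (simp add: algebra_simps)
    also have "\<dots> = (\<integral>z. h z * r n x ?v z \<partial>\<mu>) + (\<integral>z. (V ?j z - h z) * r n x ?v z \<partial>\<mu>)"
      by (intro Bochner_Integration.integral_add int v hL L2_diff VL)
    also have "\<dots> \<le> (\<integral>z. h z * r n x ?v z \<partial>\<mu>) + Rbar * ?a"
      using integral_mult_r_le[OF n x v L2_diff[OF VL hL]] by simp
    finally have "policy_value N dyn f g pol n x
        \<le> f n x ?v + (\<integral>z. h z * r n x ?v z \<partial>\<mu>) + Rbar * ?a"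
      by (simp add: policy_value_Suc[OF n x pol])
    also have "\<dots> \<le> f n x ?u + (\<integral>z. h z * r n x ?u z \<partial>\<mu>) + Rbar * ?a"
      using uhat_maximal(2)[OF n y x v] by (simp add: h_def)
    finally show "policy_value N dyn f g pol n x \<le> f n x ?u + (\<integral>z. h z * r n x ?u z \<partial>\<mu>) + Rbar * ?a" .
  qed
  have "(\<integral>z. h z * r n x ?u z \<partial>\<mu>) - (\<integral>z. W ?j y z * r n x ?u z \<partial>\<mu>)
      = (\<integral>z. (h z - W ?j y z) * r n x ?u z \<partial>\<mu>)"
    unfolding left_diff_distrib
    by (intro Bochner_Integration.integral_diff[symmetric] int u hL WL)
  also have "\<dots> \<le> Rbar * L2_norm \<mu> (\<lambda>z. h z - W ?j y z)"
    by (rule integral_mult_r_le[OF n x u L2_diff[OF hL WL]])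
  finally have "V n x - W n y x \<le> Rbar * (?a + L2_norm \<mu> (\<lambda>z. h z - W ?j y z))"
    using V W by (simp add: distrib_left)
  moreover have "W n y x \<le> V n x" using n by (intro W_le_V[OF _ order_refl y x]) simp
  ultimately show ?thesis by simp
qed

section \<open>The error recursion and its solution\<close>

definition proj_error :: real where
  "proj_error = (MAX j\<in>{1..N}. L2_norm \<mu> (\<lambda>x. L2_proj \<mu> \<phi> (V j) x - V j x))"

lemma regression_total_error:
  assumes n: "n \<in> {1..N}" and y: "y \<in> space (sim n)"
  shows "L2_norm \<mu> (\<lambda>x. V n x - lincomb \<phi> (coeff_hat n y) x)
    \<le> proj_error + L2_norm \<mu> (\<lambda>x. W n y x - V n x)
      + matrix_op_norm (inv_sqrt_matrix (gram \<mu> \<phi>)) * norm (coeff_noise n y)"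
proof -
  have n': "n \<le> N" using n by simp
  let ?h = "lincomb \<phi> (coeff_hat n y)"
  have VL: "V n \<in> L2 \<mu>" by (rule V_L2[OF n'])
  have WL: "W n y \<in> L2 \<mu>" by (rule W_L2[OF n' _ y]) simp
  have PL: "L2_proj \<mu> \<phi> h \<in> L2 \<mu>" if "h \<in> L2 \<mu>" for h
    unfolding L2_proj_eq[OF that] by (rule lincomb_L2)
  have "L2_norm \<mu> (\<lambda>x. V n x - ?h x)
    = L2_norm \<mu> (\<lambda>x. (V n x - L2_proj \<mu> \<phi> (V n) x) + ((L2_proj \<mu> \<phi> (V n) x - L2_proj \<mu> \<phi> (W n y) x)
        + (L2_proj \<mu> \<phi> (W n y) x - ?h x)))"
    by simp
  also have "\<dots> \<le> L2_norm \<mu> (\<lambda>x. V n x - L2_proj \<mu> \<phi> (V n) x)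
      + (L2_norm \<mu> (\<lambda>x. L2_proj \<mu> \<phi> (V n) x - L2_proj \<mu> \<phi> (W n y) x)
        + L2_norm \<mu> (\<lambda>x. L2_proj \<mu> \<phi> (W n y) x - ?h x))"
    by (intro order_trans[OF L2_norm_triangle] add_left_mono L2_norm_triangle L2_add L2_diff
        PL VL WL lincomb_L2)
  also have "L2_norm \<mu> (\<lambda>x. V n x - L2_proj \<mu> \<phi> (V n) x) \<le> proj_error"
    unfolding proj_error_def L2_norm_minus[of \<mu> "V n"] using n by (intro Max_ge) auto
  also have "L2_norm \<mu> (\<lambda>x. L2_proj \<mu> \<phi> (V n) x - L2_proj \<mu> \<phi> (W n y) x)
      \<le> L2_norm \<mu> (\<lambda>x. W n y x - V n x)"
    unfolding L2_proj_diff[OF VL WL] L2_norm_minus[of \<mu> "W n y"]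
    by (rule L2_proj_norm_le[OF L2_diff[OF VL WL]])
  also have "L2_norm \<mu> (\<lambda>x. L2_proj \<mu> \<phi> (W n y) x - ?h x)
      \<le> matrix_op_norm (inv_sqrt_matrix (gram \<mu> \<phi>)) * norm (coeff_noise n y)"
    unfolding L2_norm_minus[of \<mu> "L2_proj \<mu> \<phi> (W n y)"] by (rule regression_error[OF n' y])
  finally show ?thesis by simp
qed

definition stat_error :: real where
  "stat_error = sqrt (real CARD('k)) / sqrt (real M) * \<Gamma>
    * matrix_op_norm (inv_sqrt_matrix (gram \<mu> \<phi>)) * (MAX k. L2_norm \<mu> (\<phi> k))"

definition err :: "nat \<Rightarrow> real" where
  "err n = L2_norm (sim (Suc n) \<Otimes>\<^sub>M \<mu>) (\<lambda>(y, x). W n y x - V n x)"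

text \<open>The distance a from V to h counts twice, because h - W is reached through V: with d the
  distance from W to V, the total is a + (a + d). Since a is at most eps + d + s, this is 2 eps + 3
  d + 2 s, the origin of the constants 2 and 3.\<close>

lemma pointwise_error:
  assumes n: "n < N" and y: "y \<in> space (sim (Suc n))" and x: "x \<in> D"
  shows "\<bar>W n y x - V n x\<bar> \<le> 2 * Rbar * proj_error
    + 3 * Rbar * L2_norm \<mu> (\<lambda>z. W (Suc n) y z - V (Suc n) z)
    + 2 * Rbar * matrix_op_norm (inv_sqrt_matrix (gram \<mu> \<phi>)) * norm (coeff_noise (Suc n) y)"
proof -
  let ?j = "Suc n"
  let ?h = "lincomb \<phi> (coeff_hat ?j y)"
  let ?a = "L2_norm \<mu> (\<lambda>z. V ?j z - ?h z)" and ?d = "L2_norm \<mu> (\<lambda>z. W ?j y z - V ?j z)"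
  let ?s = "matrix_op_norm (inv_sqrt_matrix (gram \<mu> \<phi>)) * norm (coeff_noise ?j y)"
  have j: "?j \<le> N" using n by simp
  have VL: "V ?j \<in> L2 \<mu>" by (rule V_L2[OF j])
  have WL: "W ?j y \<in> L2 \<mu>" by (rule W_L2[OF j _ y]) simp
  have "L2_norm \<mu> (\<lambda>z. ?h z - W ?j y z) = L2_norm \<mu> (\<lambda>z. (?h z - V ?j z) + (V ?j z - W ?j y z))"
    by simp
  also have "\<dots> \<le> L2_norm \<mu> (\<lambda>z. ?h z - V ?j z) + L2_norm \<mu> (\<lambda>z. V ?j z - W ?j y z)"
    by (intro L2_norm_triangle L2_diff lincomb_L2 VL WL)
  also have "\<dots> = ?a + ?d"
    by (simp only: L2_norm_minus[of \<mu> ?h] L2_norm_minus[of \<mu> "W ?j y"])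
  finally have b: "L2_norm \<mu> (\<lambda>z. ?h z - W ?j y z) \<le> ?a + ?d" .
  have a: "?a \<le> proj_error + ?d + ?s"
    using j by (intro regression_total_error y) simp
  have "\<bar>W n y x - V n x\<bar> \<le> Rbar * (?a + L2_norm \<mu> (\<lambda>z. ?h z - W ?j y z))"
    by (rule one_step_error[OF n y x])
  also have "\<dots> \<le> Rbar * (2 * proj_error + 3 * ?d + 2 * ?s)"
    using a b Rbar by (intro mult_left_mono) auto
  finally show ?thesis by (simp add: algebra_simps)
qed

lemma err_step:
  assumes n: "n < N"
  shows "err n \<le> 3 * Rbar * err (Suc n) + 2 * Rbar * (proj_error + stat_error)"
proof -
  let ?j = "Suc n"
  let ?P = "sim ?j"
  let ?b = "matrix_op_norm (inv_sqrt_matrix (gram \<mu> \<phi>))"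
  let ?d = "\<lambda>y. L2_norm \<mu> (\<lambda>z. W ?j y z - V ?j z)" and ?s = "\<lambda>y. norm (coeff_noise ?j y)"
  have j: "?j \<le> N" and j1: "?j \<in> {1..N}" using n by simp_all
  interpret P: prob_space ?P by (rule prob_space_sim)
  interpret PM: pair_prob_space ?P \<mu> ..
  have diff: "(\<lambda>x. W ?j y x - V ?j x) \<in> L2 \<mu>" if "y \<in> space ?P" for y
    by (rule L2_diff[OF W_L2[OF j _ that] V_L2[OF j]]) simp
  have jL: "(\<lambda>(y, x). W ?j y x - V ?j x) \<in> L2 (?P \<Otimes>\<^sub>M \<mu>)" by (rule W_minus_V_L2[OF j]) simp
  have dL: "?d \<in> L2 ?P" by (rule PM.L2_norm_pair(1)[OF jL diff])
  have sL: "?s \<in> L2 ?P" by (rule coeff_noise_L2(1)[OF j1])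
  \<comment> \<open>Here \<open>y\<close> also contains the variables of time \<open>?j\<close>,
    which the regression reads but \<open>W ?j\<close> does not. Dropping them leaves the norm
    unchanged and identifies it with the error one step later.\<close>
  have d: "L2_norm ?P ?d = err ?j"
  proof -
    let ?P' = "sim (Suc ?j)"
    interpret P': prob_space ?P' by (rule prob_space_sim)
    interpret PM': pair_prob_space ?P' \<mu> ..
    have diff': "(\<lambda>x. W ?j y x - V ?j x) \<in> L2 \<mu>" if "y \<in> space ?P'" for y
      by (rule L2_diff[OF W_L2[OF j _ that] V_L2[OF j]]) simp
    have jL': "(\<lambda>(y, x). W ?j y x - V ?j x) \<in> L2 (?P' \<Otimes>\<^sub>M \<mu>)" by (rule W_minus_V_L2[OF j]) simp
    have "L2_norm ?P ?d = L2_norm ?P (\<lambda>y. ?d (sim_from N M (Suc ?j) y))"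
      by (simp add: W_sim_from[OF j])
    also have "\<dots> = L2_norm ?P' ?d"
      by (intro L2_distr(2) measurable_sim_from distr_sim_from mu(1) PM'.L2_norm_pair(1)[OF jL' diff']) simp_all
    also have "\<dots> = err ?j"
      unfolding err_def by (rule PM'.L2_norm_pair(2)[OF jL' diff'])
    finally show ?thesis .
  qed
  have b: "0 \<le> ?b" unfolding matrix_op_norm_def by (rule onorm_pos_le) simp
  let ?c = "2 * Rbar * proj_error"
  define B where "B = (\<lambda>y. ?c + (3 * Rbar * ?d y + 2 * Rbar * ?b * ?s y))"
  have cL: "(\<lambda>_. ?c) \<in> L2 ?P" by (simp add: L2_def)
  have BL: "B \<in> L2 ?P" unfolding B_def by (intro L2_add L2_scale cL dL sL)
  \<comment> \<open>The bound \<open>B\<close> is uniform in the state, so averaging over \<mu>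
    costs no further factor.\<close>
  have "err n \<le> L2_norm (?P \<Otimes>\<^sub>M \<mu>) (\<lambda>p. B (fst p))"
    unfolding err_def
  proof (rule L2_norm_mono(2))
    show "(\<lambda>p. B (fst p)) \<in> L2 (?P \<Otimes>\<^sub>M \<mu>)"
      by (rule L2_distr(1)[OF measurable_fst distr_pair_fst BL])
    show "(\<lambda>(y, x). W n y x - V n x) \<in> borel_measurable (?P \<Otimes>\<^sub>M \<mu>)"
      using n by (intro L2_measurable W_minus_V_L2) auto
    show "AE p in ?P \<Otimes>\<^sub>M \<mu>. \<bar>case p of (y, x) \<Rightarrow> W n y x - V n x\<bar> \<le> \<bar>B (fst p)\<bar>"
      using pointwise_error[OF n]
      by (intro AE_I2) (force simp: B_def space_pair_measure space_mu add.assoc)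
  qed
  also have "\<dots> = L2_norm ?P B" by (rule L2_distr(2)[OF measurable_fst distr_pair_fst BL])
  also have "\<dots> \<le> L2_norm ?P (\<lambda>_. ?c) + (L2_norm ?P (\<lambda>y. 3 * Rbar * ?d y)
      + L2_norm ?P (\<lambda>y. 2 * Rbar * ?b * ?s y))"
    unfolding B_def
    by (intro order_trans[OF L2_norm_triangle] add_left_mono L2_norm_triangle L2_add L2_scale cL dL sL)
  also have "L2_norm ?P (\<lambda>_. ?c) = ?c"
  proof -
    have "0 \<le> proj_error"
      unfolding proj_error_def using N by (intro order_trans[OF L2_norm_nonneg Max_ge]) auto
    then show ?thesis using Rbar by (simp add: L2_norm_def P.prob_space)
  qed
  also have "L2_norm ?P (\<lambda>y. 3 * Rbar * ?d y) = 3 * Rbar * err ?j"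
    using Rbar by (simp add: L2_norm_scale d)
  also have "L2_norm ?P (\<lambda>y. 2 * Rbar * ?b * ?s y) = 2 * Rbar * ?b * L2_norm ?P ?s"
    using Rbar b by (simp add: L2_norm_scale)
  also have "\<dots> \<le> 2 * Rbar * ?b * (sqrt (real CARD('k)) / sqrt (real M) * \<Gamma> * (MAX k. L2_norm \<mu> (\<phi> k)))"
    using coeff_noise_L2(2)[OF j1] Rbar b by (intro mult_left_mono) auto
  finally show ?thesis by (simp add: stat_error_def algebra_simps)
qed

lemma err_bound:
  assumes "n \<le> N"
  shows "err n \<le> 2 * Rbar * (((3 * Rbar) ^ (N - n) - 1) / (3 * Rbar - 1)) * (proj_error + stat_error)"
  using assms
proof (induction n rule: inc_induct)
  case base
  interpret P: prob_space "sim (Suc N)" by (rule prob_space_sim)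
  have "W N y x = V N x" if "x \<in> D" for y x
    using prob_space.prob_space[OF prob_space_noise_law] value_fun_terminal[OF U_nonempty that]
    by (simp add: W_def policy_value_def path_reward_def)
  then have "(\<integral>p. (case p of (y, x) \<Rightarrow> W N y x - V N x)\<^sup>2 \<partial>(sim (Suc N) \<Otimes>\<^sub>M \<mu>)) = (\<integral>p. 0 \<partial>(sim (Suc N) \<Otimes>\<^sub>M \<mu>))"
    by (intro Bochner_Integration.integral_cong) (auto simp: space_pair_measure space_mu)
  then have "err N = 0" unfolding err_def L2_norm_def by simp
  then show ?case by simp
next
  case (step n)
  let ?q = "3 * Rbar" and ?c = "proj_error + stat_error"
  have "D \<noteq> {}" using not_empty by (simp add: space_mu)
  then have "Rbar \<ge> 1" using N U_nonempty by (intro Rbar_ge_1) auto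
  then have q: "?q - 1 > 0" by simp
  have pow: "?q ^ (N - n) = ?q * ?q ^ (N - Suc n)"
  proof -
    have "N - n = Suc (N - Suc n)" using step.hyps by simp
    then show ?thesis by (simp only: power_Suc)
  qed
  have "err n \<le> ?q * err (Suc n) + 2 * Rbar * ?c" by (rule err_step[OF step.hyps(2)])
  also have "\<dots> \<le> ?q * (2 * Rbar * ((?q ^ (N - Suc n) - 1) / (?q - 1)) * ?c) + 2 * Rbar * ?c"
    using step.IH Rbar by (intro add_right_mono mult_left_mono) auto
  also have "\<dots> = 2 * Rbar * (?q * ((?q ^ (N - Suc n) - 1) / (?q - 1)) + 1) * ?c"
    by (simp add: algebra_simps)
  \<comment> \<open>One more term of the geometric series with ratio 3 Rbar; clearing the
    denominator relies on \<open>q\<close>.\<close>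
  also have "?q * ((?q ^ (N - Suc n) - 1) / (?q - 1)) + 1 = (?q ^ (N - n) - 1) / (?q - 1)"
    using q unfolding pow by (simp add: field_simps)
  finally show ?case .
qed

text \<open>\<open>Vt\<close> and \<open>W\<close> agree at every point of the underlying space,
  which transports measurability along with the norm.\<close>

lemma Vt_error:
  assumes "n \<le> N"
  shows "(\<lambda>(y, x). Vt n y x - V n x) \<in> L2 (sim (Suc n) \<Otimes>\<^sub>M \<mu>)"
    and "L2_norm (sim (Suc n) \<Otimes>\<^sub>M \<mu>) (\<lambda>(y, x). Vt n y x - V n x) = err n"
proof -
  let ?Q = "sim (Suc n) \<Otimes>\<^sub>M \<mu>"
  let ?F = "\<lambda>(y, x). Vt n y x - V n x" and ?G = "\<lambda>(y, x). W n y x - V n x"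
  have eq: "?F p = ?G p" if "p \<in> space ?Q" for p
    using that Vt_eq_W[OF assms] by (auto simp: space_pair_measure space_mu)
  have G: "?G \<in> L2 ?Q" by (rule W_minus_V_L2[OF assms]) simp
  have "integrable ?Q (\<lambda>p. (?F p)\<^sup>2) = integrable ?Q (\<lambda>p. (?G p)\<^sup>2)"
    by (rule Bochner_Integration.integrable_cong) (simp_all add: eq)
  moreover have "?F \<in> borel_measurable ?Q \<longleftrightarrow> ?G \<in> borel_measurable ?Q"
    by (rule measurable_cong) (rule eq)
  ultimately show "?F \<in> L2 ?Q" using G by (simp add: L2_def)
  have "(\<integral>p. (?F p)\<^sup>2 \<partial>?Q) = (\<integral>p. (?G p)\<^sup>2 \<partial>?Q)"
    by (rule Bochner_Integration.integral_cong) (simp_all add: eq)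
  then show "L2_norm ?Q ?F = err n" by (simp add: err_def L2_norm_def)
qed

end

theorem theorem3:
  fixes D :: "'x::euclidean_space set" and U :: "'u::euclidean_space set"
    and N M :: nat
    and \<mu> :: "'x measure"
    and dyn :: "nat \<Rightarrow> 'x \<Rightarrow> real \<Rightarrow> 'u \<Rightarrow> 'x"
    and r :: "nat \<Rightarrow> 'x \<Rightarrow> 'u \<Rightarrow> 'x \<Rightarrow> real"
    and f :: "nat \<Rightarrow> 'x \<Rightarrow> 'u \<Rightarrow> real" and g :: "'x \<Rightarrow> real"
    and \<phi> :: "'k::finite \<Rightarrow> 'x \<Rightarrow> real"
    and uhat :: "nat \<Rightarrow> 'x sim \<Rightarrow> 'x \<Rightarrow> 'u"
    and Rbar \<Gamma> :: real
  defines "V \<equiv> value_fun N D U dyn f g"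
    and "Vt \<equiv> est_policy_value N M \<mu> r f g uhat"
  assumes N: "N \<ge> 1" and M: "M \<ge> 1"
    and D: "D \<in> sets borel" and U: "compact U"
    and mu: "prob_space \<mu>" "sets \<mu> = sets (restrict_space borel D)"
    and dyn_meas: "\<And>n. n < N \<Longrightarrow>
          (\<lambda>(x, z, u). dyn n x z u) \<in> \<mu> \<Otimes>\<^sub>M unif01 \<Otimes>\<^sub>M restrict_space borel U \<rightarrow>\<^sub>M \<mu>"
    and r_meas: "\<And>n. n < N \<Longrightarrow>
          (\<lambda>(x, u, y). r n x u y) \<in> borel_measurable (\<mu> \<Otimes>\<^sub>M restrict_space borel U \<Otimes>\<^sub>M \<mu>)"
    and density: "\<And>n x u. n < N \<Longrightarrow> x \<in> D \<Longrightarrow> u \<in> U \<Longrightarrow>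
          distributed unif01 \<mu> (\<lambda>z. dyn n x z u) (\<lambda>y. ennreal (r n x u y))"
    and Rbar: "Rbar > 0"
    and r_bound: "\<And>n x u y. n < N \<Longrightarrow> x \<in> D \<Longrightarrow> u \<in> U \<Longrightarrow> y \<in> D \<Longrightarrow>
          0 \<le> r n x u y \<and> r n x u y \<le> Rbar\<^sup>2"
    and f_meas: "\<And>n. n < N \<Longrightarrow>
          (\<lambda>(x, u). f n x u) \<in> borel_measurable (\<mu> \<Otimes>\<^sub>M restrict_space borel U)"
    and f_bounded: "\<exists>B. \<forall>n<N. \<forall>x\<in>D. \<forall>u\<in>U. \<bar>f n x u\<bar> \<le> B"
    and g_meas: "g \<in> borel_measurable \<mu>"
    and g_bounded: "\<exists>B. \<forall>x\<in>D. \<bar>g x\<bar> \<le> B"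
    and V_meas: "\<And>n. n \<le> N \<Longrightarrow> V n \<in> borel_measurable \<mu>"
    and basis_L2: "\<And>k. \<phi> k \<in> L2 \<mu>"
    and basis_indep: "L2_independent \<mu> \<phi>"
    and f_usc: "\<And>n x. n < N \<Longrightarrow> x \<in> D \<Longrightarrow> usc_on U (f n x)"
    and basis_usc: "\<And>n k x. n < N \<Longrightarrow> x \<in> D \<Longrightarrow> usc_on U (basis_cond \<mu> r \<phi> n k x)"
    and policy: "performance_iteration N M \<mu> U dyn r f g \<phi> uhat"
    and Gamma_V: "\<And>n x. n \<in> {1..N} \<Longrightarrow> x \<in> D \<Longrightarrow> \<bar>V n x\<bar> \<le> \<Gamma>"
    and Gamma_sim: "\<And>n m. n \<in> {1..N} \<Longrightarrow> m \<in> {1..M} \<Longrightarrow>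
          AE y in sim_law N M \<mu> n. \<bar>sim_reward N M dyn f g uhat n m y\<bar> \<le> \<Gamma>"
  shows "\<forall>n\<le>N.
      (\<lambda>(y, x). Vt n y x - V n x) \<in> L2 (sim_law N M \<mu> (Suc n) \<Otimes>\<^sub>M \<mu>) \<and>
      L2_norm (sim_law N M \<mu> (Suc n) \<Otimes>\<^sub>M \<mu>) (\<lambda>(y, x). Vt n y x - V n x)
        \<le> 2 * Rbar * (((3 * Rbar) ^ (N - n) - 1) / (3 * Rbar - 1)) *
           ((MAX j\<in>{1..N}. L2_norm \<mu> (\<lambda>x. L2_proj \<mu> \<phi> (V j) x - V j x))
              + sqrt (real CARD('k)) / sqrt (real M) * \<Gamma>
                  * matrix_op_norm (inv_sqrt_matrix (gram \<mu> \<phi>))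
                  * (MAX k. L2_norm \<mu> (\<phi> k)))"
proof (intro allI impI)
  fix n assume n: "n \<le> N"
  interpret mu: prob_space \<mu> by (rule mu(1))
  have "space \<mu> = D"
    using sets_eq_imp_space_eq[OF mu(2)] by (simp add: space_restrict_space)
  then obtain x where "x \<in> D" using mu.not_empty by blast
  \<comment> \<open>The sign of \<Gamma> comes from the bound on \<open>V N\<close> at a single
    state.\<close>
  then have "0 \<le> \<Gamma>" using Gamma_V[of N x] N by (simp add: order_trans[OF abs_ge_zero])
  then interpret regress_later D U N \<mu> dyn r f g Rbar \<phi> M uhat \<Gamma>
    using assms by unfold_locales auto
  show "(\<lambda>(y, x). Vt n y x - V n x) \<in> L2 (sim_law N M \<mu> (Suc n) \<Otimes>\<^sub>M \<mu>) \<and>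
      L2_norm (sim_law N M \<mu> (Suc n) \<Otimes>\<^sub>M \<mu>) (\<lambda>(y, x). Vt n y x - V n x)
        \<le> 2 * Rbar * (((3 * Rbar) ^ (N - n) - 1) / (3 * Rbar - 1)) *
           ((MAX j\<in>{1..N}. L2_norm \<mu> (\<lambda>x. L2_proj \<mu> \<phi> (V j) x - V j x))
              + sqrt (real CARD('k)) / sqrt (real M) * \<Gamma>
                  * matrix_op_norm (inv_sqrt_matrix (gram \<mu> \<phi>))
                  * (MAX k. L2_norm \<mu> (\<phi> k)))"
    using Vt_error[OF n] err_bound[OF n]
    unfolding V_def Vt_def proj_error_def stat_error_def by simp
qed

end
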